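(* Let $\hat k$ be a quadratic extension of $k$, let $M\in(\mathrm{Im}\,\hat k^* )^2=\{q^2:q\in\mathrm{Im}\,\hat k^*\}$, let $\mathcal{O}_M=\{P\in S^3((k^2)^* ): Q_n(P)=M\}$ and let $\mathcal{O}_M/\mathrm{Sl}(2,k)$ be the space of $\mathrm{Sl}(2,k)$-orbits in $\mathcal{O}_M$. (i) The map $I_{\widehat{\mathcal{O}}_{[1]}}:\mathcal{O}(\hat k)\to\mathrm{Im}\,\hat k^*\times_{Z_2}U(\hat k^*/\hat k^{*3})$ induces a bijection from $\mathcal{O}_M/\mathrm{Sl}(2,k)$ onto $\widehat{sq}^{-1}(M)$ and, by pullback of the group structure $[q,u_1]\times[q,u_2]=[q,u_1u_2]$ on $\widehat{sq}^{-1}(M)$ (where $q^2=M$), a group structure on $\mathcal{O}_M/\mathrm{Sl}(2,k)$. (ii) As groups, $\mathcal{O}_M/\mathrm{Sl}(2,k)\cong U(\hat k^*/\hat k^{*3})$. (iii) The identity element of $\mathcal{O}_M/\mathrm{Sl}(2,k)$ is characterised as follows: for $P\in\mathcal{O}_M$, $\mathrm{Sl}(2,k)\cdot P=1$ if and only if $P$ is reducible over $k$.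
   Context: $k$ is a field of characteristic different from $2$ and $3$; $x,y$ is the standard coordinate basis of $(k^2)^*$; $S^3((k^2)^* )=\{ax^3+3bx^2y+3cxy^2+dy^3: a,b,c,d\in k\}$ is the space of binary cubics. $\mathrm{Sl}(2,k)$ acts on $(k^2)^*$ by transpose inverse, $(g\cdot\phi)(v)=\phi(g^{-1}v)$, and functorially on $S^3((k^2)^* )$. The symplectic form is $\omega(P,P')=ad'-da'-3bc'+3cb'$ for $P=ax^3+3bx^2y+3cxy^2+dy^3$, $P'=a'x^3+3b'x^2y+3c'xy^2+d'y^3$, and $Q_n(P)=a^2d^2-3b^2c^2-6abcd+4b^3d+4ac^3$. For the quadratic extension $\hat k/k$ (Galois since $\mathrm{char}\,k\ne2$), $z\mapsto\bar z$ denotes the action of the generator of $\mathrm{Gal}(\hat k/k)\cong Z_2$ on $\hat k$ and on any space obtained by base extension from $k$; $\hat\omega$ is the base extension of $\omega$ to $S^3((\hat k^2)^* )$. $\mathrm{Im}\,\hat k=\{\lambda\in\hat k:\bar\lambda=-\lambda\}$ and $\mathrm{Im}\,\hat k^*$ is its set of nonzero elements. $U(\hat k^*/\hat k^{*3})=\{\alpha\in\hat k^*/\hat k^{*3}:\alpha\bar\alpha=1\}$. $\mathrm{Im}\,\hat k^*\times_{Z_2}U(\hat k^*/\hat k^{*3})$ is the quotient of $\mathrm{Im}\,\hat k^*\times U(\hat k^*/\hat k^{*3})$ by the $Z_2$-action $-1\cdot(\xi,\alpha)=(-\xi,\alpha^{-1})$ (the natural Galois action); the class of $(\xi,\alpha)$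 is $[\xi,\alpha]$. $\mathcal{O}(\hat k)=\{P\in S^3((k^2)^* ):\hat k\text{ is a splitting field of }X^2-Q_n(P)\}=\{P: Q_n(P)\in(\mathrm{Im}\,\hat k^* )^2\}$. Every $P\in\mathcal{O}(\hat k)$ can be written $P=\lambda\alpha^3+\bar\lambda\bar\alpha^3$ with $\lambda\in\hat k^*$, $\alpha\in(\hat k^2)^*$ and $\alpha,\bar\alpha$ linearly independent; the unordered pair of summands is unique and $Q_n(P)=\hat\omega(\lambda\alpha^3,\bar\lambda\bar\alpha^3)^2$. The ($\mathrm{Sl}(2,k)$-invariant, well-defined) map $I_{\widehat{\mathcal{O}}_{[1]}}$ is $I_{\widehat{\mathcal{O}}_{[1]}}(P)=[\hat\omega(\lambda\alpha^3,\bar\lambda\bar\alpha^3),[\lambda\bar\lambda^{-1}]]$. The map $\widehat{sq}:\mathrm{Im}\,\hat k^*\times_{Z_2}U(\hat k^*/\hat k^{*3})\to(\mathrm{Im}\,\hat k^* )^2$ is $\widehat{sq}([q,\alpha])=q^2$. Each fibre $\widehat{sq}^{-1}(q^2)$ has the group structure $[q,u_1]\times[q,u_2]=[q,u_1u_2]$, independent of the choice of the square root $q$ of $q^2$, with identity $[q,1]$. *)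

theory Defs
  imports
    "HOL-Analysis.Determinants"
    "HOL-Computational_Algebra.Polynomial"
    "HOL-Computational_Algebra.Factorial_Ring"
    "HOL-Algebra.Coset"
    "HOL-Algebra.Group_Action"
begin

section \<open>Binary cubics\<close>

text \<open>
  The polynomial ring \<open>k[x,y]\<close> is the type \<open>'a poly poly\<close>, read as \<open>k[x][y]\<close>: the inner
  indeterminate is \<open>x\<close>, the outer one is \<open>y\<close>.
\<close>

definition const2 :: "'a::comm_ring_1 \<Rightarrow> 'a poly poly" where
  "const2 c = [:[:c:]:]"

definition var_x :: "'a::comm_ring_1 poly poly" where
  "var_x = [:[:0, 1:]:]"

definition var_y :: "'a::comm_ring_1 poly poly" where
  "var_y = [:0, 1:]"

definition cubic :: "'a::field \<Rightarrow> 'a \<Rightarrow> 'a \<Rightarrow> 'a \<Rightarrow> 'a poly poly" where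
  "cubic a b c d = const2 a * var_x ^ 3 + const2 (3 * b) * var_x ^ 2 * var_y
     + const2 (3 * c) * var_x * var_y ^ 2 + const2 d * var_y ^ 3"

definition binary_cubics :: "'a::field poly poly set" where
  "binary_cubics = {cubic a b c d | a b c d. True}"

text \<open>The coordinates \<open>a, b, c, d\<close> of a binary cubic (in characteristic different from 3).\<close>

definition cf_a :: "'a::field poly poly \<Rightarrow> 'a" where
  "cf_a P = coeff (coeff P 0) 3"

definition cf_b :: "'a::field poly poly \<Rightarrow> 'a" where
  "cf_b P = coeff (coeff P 1) 2 / 3"

definition cf_c :: "'a::field poly poly \<Rightarrow> 'a" where
  "cf_c P = coeff (coeff P 2) 1 / 3"

definition cf_d :: "'a::field poly poly \<Rightarrow> 'a" where
  "cf_d P = coeff (coeff P 3) 0"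

definition omega :: "'a::field poly poly \<Rightarrow> 'a poly poly \<Rightarrow> 'a" where
  "omega P P' = cf_a P * cf_d P' - cf_d P * cf_a P' - 3 * cf_b P * cf_c P' + 3 * cf_c P * cf_b P'"

definition Qn :: "'a::field poly poly \<Rightarrow> 'a" where
  "Qn P = cf_a P ^ 2 * cf_d P ^ 2 - 3 * cf_b P ^ 2 * cf_c P ^ 2
     - 6 * cf_a P * cf_b P * cf_c P * cf_d P + 4 * cf_b P ^ 3 * cf_d P + 4 * cf_a P * cf_c P ^ 3"

text \<open>
  A linear form on the plane is given by its coordinates in the basis \<open>x, y\<close>;
  \<open>lin_form\<close> is the corresponding element of \<open>k[x,y]\<close>.
\<close>

definition lin_form :: "'a::field ^ 2 \<Rightarrow> 'a poly poly" where
  "lin_form p = const2 (p $ 1) * var_x + const2 (p $ 2) * var_y"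

definition reducible :: "'a::field poly poly \<Rightarrow> bool" where
  "reducible P \<longleftrightarrow> P \<noteq> 0 \<and> \<not> P dvd 1 \<and> \<not> irreducible P"

section \<open>The action of the special linear group\<close>

definition SL2 :: "('a::field ^ 2 ^ 2) monoid" where
  "SL2 = \<lparr>carrier = {g. det g = 1}, monoid.mult = (**), one = mat 1\<rparr>"

text \<open>\<open>(g \<cdot> \<phi>)(v) = \<phi>(g\<inverse> v)\<close>, in coordinates with respect to the basis \<open>x, y\<close>.\<close>

definition dual_act :: "'a::field ^ 2 ^ 2 \<Rightarrow> 'a ^ 2 \<Rightarrow> 'a ^ 2" where
  "dual_act g p = transpose (matrix_inv g) *v p"

definition subst2 :: "'a::field poly poly \<Rightarrow> 'a poly poly \<Rightarrow> 'a poly poly \<Rightarrow> 'a poly poly" where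
  "subst2 X Y P = poly (map_poly (\<lambda>p. poly (map_poly const2 p) X) P) Y"

text \<open>
  The functorial action: the algebra endomorphism of \<open>k[x,y]\<close>, the symmetric algebra of the dual
  plane, that extends \<open>dual_act g\<close>, i.e. the one sending \<open>x\<close> to \<open>g \<cdot> x\<close> and \<open>y\<close> to \<open>g \<cdot> y\<close>.
\<close>

definition cubic_act :: "'a::field ^ 2 ^ 2 \<Rightarrow> 'a poly poly \<Rightarrow> 'a poly poly" where
  "cubic_act g = subst2 (lin_form (dual_act g (axis 1 1))) (lin_form (dual_act g (axis 2 1)))"

section \<open>Quadratic extensions\<close>

text \<open>
  The extension is given by its embedding \<open>\<iota>\<close>; the degree is the dimension of the big field as a
  vector space over the small one (and \<open>dim = 2\<close> excludes the infinite-dimensional case, where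
  \<open>dim\<close> is 0).
\<close>

definition quadratic_extension :: "('k::field \<Rightarrow> 'l::field) \<Rightarrow> bool" where
  "quadratic_extension \<iota> \<longleftrightarrow>
     \<iota> 1 = 1 \<and> (\<forall>a b. \<iota> (a + b) = \<iota> a + \<iota> b) \<and> (\<forall>a b. \<iota> (a * b) = \<iota> a * \<iota> b) \<and>
     vector_space.dim (\<lambda>c z. \<iota> c * z) (UNIV :: 'l set) = 2"

definition galois_group :: "('k::field \<Rightarrow> 'l::field) \<Rightarrow> ('l \<Rightarrow> 'l) set" where
  "galois_group \<iota> = {\<sigma>. bij \<sigma> \<and> (\<forall>z w. \<sigma> (z + w) = \<sigma> z + \<sigma> w) \<and>
     (\<forall>z w. \<sigma> (z * w) = \<sigma> z * \<sigma> w) \<and> (\<forall>c. \<sigma> (\<iota> c) = \<iota> c)}"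

text \<open>
  For a quadratic extension in characteristic different from 2 the Galois group has order 2, so
  its generator is its unique non-identity element.
\<close>

definition gal_conj :: "('k::field \<Rightarrow> 'l::field) \<Rightarrow> 'l \<Rightarrow> 'l" where
  "gal_conj \<iota> = (THE \<sigma>. \<sigma> \<in> galois_group \<iota> \<and> \<sigma> \<noteq> id)"

definition conj_vec :: "('k::field \<Rightarrow> 'l::field) \<Rightarrow> 'l ^ 2 \<Rightarrow> 'l ^ 2" where
  "conj_vec \<iota> p = (\<chi> i. gal_conj \<iota> (p $ i))"

definition base_ext :: "('k::field \<Rightarrow> 'l::field) \<Rightarrow> 'k poly poly \<Rightarrow> 'l poly poly" where
  "base_ext \<iota> = map_poly (map_poly \<iota>)"

definition Im_star :: "('k::field \<Rightarrow> 'l::field) \<Rightarrow> 'l set" where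
  "Im_star \<iota> = {z. gal_conj \<iota> z = - z \<and> z \<noteq> 0}"

definition Im_star_sq :: "('k::field \<Rightarrow> 'l::field) \<Rightarrow> 'l set" where
  "Im_star_sq \<iota> = {q ^ 2 | q. q \<in> Im_star \<iota>}"

definition field_units :: "'l::field monoid" where
  "field_units = \<lparr>carrier = UNIV - {0}, monoid.mult = (*), one = 1\<rparr>"

definition unit_cubes :: "'l::field set" where
  "unit_cubes = {z ^ 3 | z. z \<noteq> 0}"

definition cube_classes :: "'l::field set monoid" where
  "cube_classes = field_units Mod unit_cubes"

definition cube_class :: "'l::field \<Rightarrow> 'l set" where
  "cube_class z = unit_cubes #>\<^bsub>field_units\<^esub> z"

definition U_group :: "('k::field \<Rightarrow> 'l::field) \<Rightarrow> 'l set monoid" where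
  "U_group \<iota> = cube_classes
     \<lparr>carrier := {u \<in> carrier cube_classes. u \<otimes>\<^bsub>cube_classes\<^esub> (gal_conj \<iota> ` u) = \<one>\<^bsub>cube_classes\<^esub>}\<rparr>"

section \<open>The space of invariants\<close>

text \<open>The orbit of \<open>(\<xi>, u)\<close> under the action \<open>-1 \<cdot> (\<xi>, u) = (-\<xi>, u\<inverse>)\<close>.\<close>

definition Z2_class :: "'l::field \<Rightarrow> 'l set \<Rightarrow> ('l \<times> 'l set) set" where
  "Z2_class \<xi> u = {(\<xi>, u), (- \<xi>, inv\<^bsub>cube_classes\<^esub> u)}"

definition Im_times_U :: "('k::field \<Rightarrow> 'l::field) \<Rightarrow> ('l \<times> 'l set) set set" where
  "Im_times_U \<iota> = {Z2_class \<xi> u | \<xi> u. \<xi> \<in> Im_star \<iota> \<and> u \<in> carrier (U_group \<iota>)}"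

definition sq_hat :: "('l::field \<times> 'l set) set \<Rightarrow> 'l" where
  "sq_hat C = the_elem ((\<lambda>(\<xi>, u). \<xi> ^ 2) ` C)"

text \<open>
  The fibre of \<open>sq_hat\<close> over \<open>M\<close> with its group structure \<open>[q,u\<^sub>1] \<times> [q,u\<^sub>2] = [q,u\<^sub>1u\<^sub>2]\<close>, which
  does not depend on the square root \<open>q\<close> of \<open>M\<close>.
\<close>

definition sq_fibre :: "('k::field \<Rightarrow> 'l::field) \<Rightarrow> 'l \<Rightarrow> ('l \<times> 'l set) set monoid" where
  "sq_fibre \<iota> M =
     \<lparr>carrier = {C \<in> Im_times_U \<iota>. sq_hat C = M},
      monoid.mult = (\<lambda>C D. THE E. \<exists>q u v. q \<in> Im_star \<iota> \<and> q ^ 2 = M \<and>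
         u \<in> carrier (U_group \<iota>) \<and> v \<in> carrier (U_group \<iota>) \<and>
         C = Z2_class q u \<and> D = Z2_class q v \<and> E = Z2_class q (u \<otimes>\<^bsub>U_group \<iota>\<^esub> v)),
      one = (THE E. \<exists>q. q \<in> Im_star \<iota> \<and> q ^ 2 = M \<and> E = Z2_class q \<one>\<^bsub>U_group \<iota>\<^esub>)\<rparr>"

section \<open>The invariant and the orbit spaces\<close>

definition O_hat :: "('k::field \<Rightarrow> 'l::field) \<Rightarrow> 'k poly poly set" where
  "O_hat \<iota> = {P \<in> binary_cubics. \<iota> (Qn P) \<in> Im_star_sq \<iota>}"

text \<open>
  \<open>P = \<lambda>\<alpha>\<^sup>3 + \<lambda>'\<alpha>'\<^sup>3\<close> over the extension, where \<open>\<lambda>', \<alpha>'\<close> are the conjugates of \<open>\<lambda>, \<alpha>\<close>. The condition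
  \<open>\<alpha> \<noteq> \<alpha>'\<close> is needed because independence is a property of the set \<open>{\<alpha>, \<alpha>'}\<close>.
\<close>

definition is_decomposition ::
  "('k::field \<Rightarrow> 'l::field) \<Rightarrow> 'k poly poly \<Rightarrow> 'l \<Rightarrow> 'l ^ 2 \<Rightarrow> bool" where
  "is_decomposition \<iota> P lam \<alpha> \<longleftrightarrow>
     lam \<noteq> 0 \<and> \<alpha> \<noteq> conj_vec \<iota> \<alpha> \<and> vec.independent {\<alpha>, conj_vec \<iota> \<alpha>} \<and>
     base_ext \<iota> P = const2 lam * lin_form \<alpha> ^ 3
        + const2 (gal_conj \<iota> lam) * lin_form (conj_vec \<iota> \<alpha>) ^ 3"

text \<open>The value does not depend on the decomposition.\<close>

definition I_hat :: "('k::field \<Rightarrow> 'l::field) \<Rightarrow> 'k poly poly \<Rightarrow> ('l \<times> 'l set) set" where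
  "I_hat \<iota> P = (THE C. \<exists>lam \<alpha>. is_decomposition \<iota> P lam \<alpha> \<and>
     C = Z2_class
       (omega (const2 lam * lin_form \<alpha> ^ 3)
              (const2 (gal_conj \<iota> lam) * lin_form (conj_vec \<iota> \<alpha>) ^ 3))
       (cube_class (lam * inverse (gal_conj \<iota> lam))))"

definition O_level :: "('k::field \<Rightarrow> 'l::field) \<Rightarrow> 'l \<Rightarrow> 'k poly poly set" where
  "O_level \<iota> M = {P \<in> binary_cubics. \<iota> (Qn P) = M}"

definition SL2_orbit :: "'k::field poly poly \<Rightarrow> 'k poly poly set" where
  "SL2_orbit P = orbit SL2 cubic_act P"

definition O_orbits :: "('k::field \<Rightarrow> 'l::field) \<Rightarrow> 'l \<Rightarrow> 'k poly poly set set" where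
  "O_orbits \<iota> M = orbits SL2 (O_level \<iota> M) cubic_act"

text \<open>The map on orbits induced by \<open>I_hat\<close>, which is constant on each orbit.\<close>

definition I_orb :: "('k::field \<Rightarrow> 'l::field) \<Rightarrow> 'k poly poly set \<Rightarrow> ('l \<times> 'l set) set" where
  "I_orb \<iota> A = the_elem (I_hat \<iota> ` A)"

text \<open>Pullback of a group structure along a bijection \<open>f\<close> from \<open>S\<close> onto \<open>carrier G\<close>.\<close>

definition pullback_group :: "'a set \<Rightarrow> ('a \<Rightarrow> 'b) \<Rightarrow> 'b monoid \<Rightarrow> 'a monoid" where
  "pullback_group S f G =
     \<lparr>carrier = S,
      monoid.mult = (\<lambda>a b. inv_into S f (f a \<otimes>\<^bsub>G\<^esub> f b)),
      one = inv_into S f \<one>\<^bsub>G\<^esub>\<rparr>"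

definition orbit_group :: "('k::field \<Rightarrow> 'l::field) \<Rightarrow> 'l \<Rightarrow> 'k poly poly set monoid" where
  "orbit_group \<iota> M = pullback_group (O_orbits \<iota> M) (I_orb \<iota>) (sq_fibre \<iota> M)"

end

theory Submission
  imports Defs
begin

text \<open>
  Write \<open>bar\<close> for the nontrivial automorphism of the quadratic extension. The Hessian of a cubic \<open>P\<close> is a
  binary quadratic form whose discriminant is \<open>Qn P\<close>. If \<open>Qn P = q\<^sup>2\<close> with \<open>q\<close> imaginary, the Hessian is
  irreducible over the base field and has two conjugate roots in the extension; the corresponding
  linear forms \<open>\<alpha>\<close> and \<open>bar \<alpha>\<close> diagonalise the cubic, \<open>P = \<lambda>\<alpha>\<^sup>3 + bar \<lambda> bar \<alpha>\<^sup>3\<close>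
  (\<open>decomposition_exists\<close>). Polarising this identity shows that only a rescaling of \<open>\<alpha>\<close>, compensated in \<open>\<lambda>\<close>, and
  the exchange of the two summands are free (\<open>decomposition_unique\<close>). Scaling changes \<open>\<lambda> / bar \<lambda>\<close> by a cube and fixes
  \<open>\<omega>(\<lambda>\<alpha>\<^sup>3, bar \<lambda> bar \<alpha>\<^sup>3)\<close>; the exchange inverts the former and negates the latter. So \<open>I_hat\<close> can be read
  off from any decomposition (\<open>I_hat_eq\<close>). A unimodular substitution over the base field carries
  decompositions to decompositions without changing either quantity, so \<open>I_hat\<close> is constant on orbits.

  Conversely, let \<open>P\<close> and \<open>P'\<close>, with data \<open>(\<lambda>, \<alpha>)\<close> and \<open>(\<mu>, \<beta>)\<close>, have the same invariant. Hilbert 90 turns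
  the equality of cube classes into \<open>\<lambda> = \<kappa> s\<^sup>3 \<mu>\<close> with \<open>\<kappa>\<close> in the base field, and equality of the values of
  \<open>\<omega>\<close> forces \<open>\<kappa>\<close> to be a cube. Hence \<open>\<lambda> r\<^sup>3 = \<mu>\<close> for some \<open>r\<close>, and the linear map sending \<open>\<alpha>\<close> to \<open>r\<beta>\<close> and
  \<open>bar \<alpha>\<close> to its conjugate is defined over the base field, has determinant 1 and takes \<open>P\<close> to \<open>P'\<close>
  (\<open>same_invariant_imp_orbit\<close>). Orbits in a level set are therefore exactly the fibres of \<open>I_hat\<close>, and every
  point of the fibre of the squaring map is attained by an explicit pair \<open>(\<lambda>, \<alpha>)\<close> (\<open>I_hat_onto\<close>). Fixing a
  square root \<open>q\<close> of \<open>M\<close> identifies that fibre with the group of unitary cube classes, which gives all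
  the group statements by transport of structure.

  Finally, a cubic is reducible over the base field precisely when it has a zero there
  (\<open>reducible_iff_zero\<close>). At such a point \<open>v\<close> one has \<open>\<lambda> / bar \<lambda> = (- bar \<alpha>(v) / \<alpha>(v))\<^sup>3\<close>, and every cube of
  norm 1 arises from some \<open>v\<close> in this way because \<open>\<alpha>\<close> maps the plane over the base field onto the
  extension. So the reducible cubics are those with trivial cube class, that is, those in the identity
  orbit (\<open>reducible_iff_ratio_cube\<close>).
\<close>

section \<open>Binary cubics in coordinates\<close>

definition wedge :: "'a::field ^ 2 \<Rightarrow> 'a ^ 2 \<Rightarrow> 'a" where
  "wedge p q = p $ 1 * q $ 2 - p $ 2 * q $ 1"

lemma lin_form_pCons: "lin_form p = [:[:0, p $ 1:], [:p $ 2:]:]"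
  by (simp add: lin_form_def const2_def var_x_def var_y_def)

lemma cubic_pCons:
  "cubic a b c d = [:[:0, 0, 0, a:], [:0, 0, 3 * b:], [:0, 3 * c:], [:d:]:]"
  by (simp add: cubic_def const2_def var_x_def var_y_def power3_eq_cube power2_eq_square)

lemma cubic_add:
  "cubic a b c d + cubic a' b' c' d' = cubic (a + a') (b + b') (c + c') (d + d')"
  by (simp add: cubic_pCons algebra_simps)

lemma scaled_cube_eq_cubic:
  "const2 l * lin_form p ^ 3
    = cubic (l * p $ 1 ^ 3) (l * p $ 1 ^ 2 * p $ 2) (l * p $ 1 * p $ 2 ^ 2) (l * p $ 2 ^ 3)"
  by (simp add: cubic_pCons const2_def lin_form_pCons power3_eq_cube power2_eq_square algebra_simps)

lemma cubic_coordinates: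
  assumes "(3 :: 'a::field) \<noteq> 0"
  shows "cf_a (cubic a b c (d :: 'a)) = a" "cf_b (cubic a b c d) = b"
    "cf_c (cubic a b c d) = c" "cf_d (cubic a b c d) = d"
  using assms
  by (simp_all add: cubic_pCons cf_a_def cf_b_def cf_c_def cf_d_def numeral_eq_Suc)

lemma cubic_eq_iff:
  assumes "(3 :: 'a::field) \<noteq> 0"
  shows "cubic a b c (d :: 'a) = cubic a' b' c' d' \<longleftrightarrow> a = a' \<and> b = b' \<and> c = c' \<and> d = d'"
  using assms by (auto simp: cubic_pCons)

lemma omega_scaled_cubes:
  assumes "(3 :: 'a::field) \<noteq> 0"
  shows "omega (const2 (l :: 'a) * lin_form p ^ 3) (const2 m * lin_form q ^ 3) = l * m * wedge p q ^ 3"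
  unfolding scaled_cube_eq_cubic omega_def cubic_coordinates[OF assms] wedge_def
  by (simp add: algebra_simps power3_eq_cube power2_eq_square)

lemma Qn_sum_of_scaled_cubes:
  assumes "(3 :: 'a::field) \<noteq> 0"
  shows "Qn (const2 (l :: 'a) * lin_form p ^ 3 + const2 m * lin_form q ^ 3)
    = (l * m * wedge p q ^ 3) ^ 2"
  unfolding scaled_cube_eq_cubic cubic_add Qn_def cubic_coordinates[OF assms] wedge_def
  by algebra

lemma subst2_cubic:
  "subst2 X Y (cubic a b c d)
    = const2 a * X ^ 3 + const2 (3 * b) * X ^ 2 * Y + const2 (3 * c) * X * Y ^ 2 + const2 d * Y ^ 3"
proof -
  have c0: "const2 (0 :: 'a) = 0"
    by (simp add: const2_def)
  show ?thesis
    by (simp add: subst2_def cubic_pCons map_poly_pCons c0 algebra_simps power3_eq_cube power2_eq_square)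
qed

lemma subst2_lin_form_cubic:
  "subst2 (lin_form u) (lin_form v) (cubic a b c d) = cubic
     (a * u $ 1 ^ 3 + 3 * b * u $ 1 ^ 2 * v $ 1 + 3 * c * u $ 1 * v $ 1 ^ 2 + d * v $ 1 ^ 3)
     (a * u $ 1 ^ 2 * u $ 2 + b * (u $ 1 ^ 2 * v $ 2 + 2 * u $ 1 * u $ 2 * v $ 1)
       + c * (2 * u $ 1 * v $ 1 * v $ 2 + u $ 2 * v $ 1 ^ 2) + d * v $ 1 ^ 2 * v $ 2)
     (a * u $ 1 * u $ 2 ^ 2 + b * (u $ 2 ^ 2 * v $ 1 + 2 * u $ 1 * u $ 2 * v $ 2)
       + c * (2 * u $ 2 * v $ 1 * v $ 2 + u $ 1 * v $ 2 ^ 2) + d * v $ 1 * v $ 2 ^ 2)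
     (a * u $ 2 ^ 3 + 3 * b * u $ 2 ^ 2 * v $ 2 + 3 * c * u $ 2 * v $ 2 ^ 2 + d * v $ 2 ^ 3)"
  unfolding subst2_cubic
  by (simp add: cubic_pCons lin_form_pCons const2_def algebra_simps power3_eq_cube power2_eq_square)

lemma det_rows: "det ((\<chi> i. if i = 1 then u else v) :: 'a::field ^ 2 ^ 2) = wedge u v"
  by (simp add: det_2 wedge_def)

lemma dual_act_axis: "dual_act g (axis i 1) = (matrix_inv g :: 'a::field ^ 2 ^ 2) $ i"
  by (simp add: dual_act_def matrix_vector_mult_def axis_def transpose_def vec_eq_iff if_distrib
      cong: if_cong)

text \<open>
  Row \<open>i\<close> of \<open>g\<inverse>\<close> is the image of the \<open>i\<close>-th basis form under \<open>g\<close>, so \<open>g\<close> can be recovered from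
  an arbitrary unimodular pair of forms.
\<close>

lemma SL2_iff_unimodular_pair:
  "(\<exists>g \<in> carrier SL2. dual_act g (axis 1 1) = u \<and> dual_act g (axis 2 1) = v)
    \<longleftrightarrow> wedge u v = (1 :: 'a::field)"
proof -
  have inv: "invertible g \<and> det (matrix_inv g) = 1 \<and> matrix_inv (matrix_inv g) = g"
    if "det g = 1" for g :: "'a ^ 2 ^ 2"
  proof -
    have i: "invertible g"
      using that by (simp add: invertible_det_nz)
    have "matrix_inv g ** g = mat 1" "g ** matrix_inv g = mat 1"
      using i someI_ex[of "\<lambda>A. g ** A = mat 1 \<and> A ** g = mat 1"]
      unfolding invertible_def matrix_inv_def by blast+
    note gi = this
    then have d: "det (matrix_inv g) = 1"
      using that by (metis det_I det_mul mult_1)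
    then have "\<exists>h. matrix_inv g ** h = mat 1 \<and> h ** matrix_inv g = mat 1"
      using gi by blast
    then have "matrix_inv (matrix_inv g) ** matrix_inv g = mat 1"
      unfolding matrix_inv_def[of "matrix_inv g"] by (rule someI2_ex) simp
    then have "matrix_inv (matrix_inv g) = g"
      using gi by (metis matrix_mul_assoc matrix_mul_lid matrix_mul_rid)
    then show ?thesis
      using i d by simp
  qed
  show ?thesis
  proof
    assume "\<exists>g \<in> carrier SL2. dual_act g (axis 1 1) = u \<and> dual_act g (axis 2 1) = v"
    then obtain g where g: "det g = 1" "matrix_inv g $ 1 = u" "matrix_inv g $ 2 = v"
      by (auto simp: SL2_def dual_act_axis)
    then have "det (matrix_inv g) = wedge u v"
      by (auto simp: det_2 wedge_def)
    then show "wedge u v = 1"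
      using inv[OF g(1)] by simp
  next
    define R :: "'a ^ 2 ^ 2" where "R = (\<chi> i. if i = 1 then u else v)"
    assume "wedge u v = 1"
    then have "det R = 1"
      by (simp add: R_def det_rows)
    from inv[OF this] show "\<exists>g \<in> carrier SL2. dual_act g (axis 1 1) = u \<and> dual_act g (axis 2 1) = v"
      by (intro bexI[of _ "matrix_inv R"]) (auto simp: SL2_def dual_act_axis R_def)
  qed
qed

lemma SL2_orbit_eq:
  "SL2_orbit P = {subst2 (lin_form u) (lin_form v) P | u v. wedge u v = 1}"
proof -
  have "SL2_orbit P = {subst2 (lin_form u) (lin_form v) P | u v.
      \<exists>g \<in> carrier SL2. dual_act g (axis 1 1) = u \<and> dual_act g (axis 2 1) = v}"
    unfolding SL2_orbit_def orbit_def cubic_act_def by blast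
  then show ?thesis
    unfolding SL2_iff_unimodular_pair .
qed

section \<open>Reducibility and zeros\<close>

definition cubic_zero :: "'a::field \<Rightarrow> 'a \<Rightarrow> 'a \<Rightarrow> 'a \<Rightarrow> 'a \<Rightarrow> 'a \<Rightarrow> bool" where
  "cubic_zero a b c d x y \<longleftrightarrow> (x \<noteq> 0 \<or> y \<noteq> 0)
     \<and> a * x ^ 3 + 3 * b * x ^ 2 * y + 3 * c * x * y ^ 2 + d * y ^ 3 = 0"

lemma poly_poly_unit_iff:
  "(F :: 'a::field poly poly) dvd 1 \<longleftrightarrow> (\<exists>f. f \<noteq> 0 \<and> F = [:[:f:]:])"
  by (auto simp: is_unit_poly_iff is_unit_pCons_iff is_unit_const_poly_iff dvd_field_iff)

text \<open>
  A factor of degree 1 in \<open>y\<close> whose leading coefficient is a constant can be solved for \<open>y\<close> after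
  setting \<open>x = 1\<close>.
\<close>

lemma linear_factor_imp_zero:
  fixes F :: "'a::field poly poly"
  assumes F: "F dvd cubic a b c d" "degree F = 1" "degree (lead_coeff F) = 0"
  shows "\<exists>y. cubic_zero a b c d 1 y"
proof -
  obtain f f0 where Ff: "F = [:f0, [:f:]:]" "f \<noteq> 0"
  proof -
    obtain f0 f1 where "F = [:f0, f1:]" "f1 \<noteq> 0"
      using F(2) by (cases F) (auto split: if_splits elim!: degree_eq_zeroE)
    then show ?thesis
      using F(3) that by (auto elim!: degree_eq_zeroE)
  qed
  define y where "y = - poly f0 1 / f"
  have "poly (poly F [:y:]) 1 = 0"
    using Ff(2) by (simp add: Ff(1) y_def)
  then have "poly (poly (cubic a b c d) [:y:]) 1 = 0"
    using F(1) by (auto elim!: dvdE)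
  then have "cubic_zero a b c d 1 y"
    by (simp add: cubic_pCons cubic_zero_def algebra_simps power3_eq_cube power2_eq_square)
  then show ?thesis ..
qed

text \<open>
  If \<open>d = 0\<close>, then \<open>(0, 1)\<close> is a zero. Otherwise \<open>P\<close> has degree 3 in \<open>y\<close> with a unit as leading
  coefficient, so both factors have unit leading coefficients; being nonunits, they have positive
  degree in \<open>y\<close>, and one of the two degrees is 1.
\<close>

lemma reducible_imp_zero:
  assumes "reducible (cubic a b c d)"
  shows "\<exists>x y. cubic_zero a b c d x y"
proof (cases "d = 0")
  case True
  then have "cubic_zero a b c d 0 1"
    by (simp add: cubic_zero_def)
  then show ?thesis by blast
next
  case False
  obtain F G where FG: "cubic a b c d = F * G" "\<not> F dvd 1" "\<not> G dvd 1"
    using assms by (auto simp: reducible_def irreducible_def)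
  have lc: "lead_coeff F * lead_coeff G = [:d:]" and deg: "degree (F * G) = 3"
    unfolding lead_coeff_mult[symmetric] FG(1)[symmetric] using False by (simp_all add: cubic_pCons)
  have nz: "F \<noteq> 0" "G \<noteq> 0"
    using deg by auto
  have "degree (lead_coeff F) + degree (lead_coeff G) = 0"
    using arg_cong[OF lc, of degree] nz by (simp add: degree_mult_eq)
  then have lcs: "degree (lead_coeff F) = 0" "degree (lead_coeff G) = 0"
    by auto
  have pos: "degree H \<noteq> 0" if "\<not> H dvd 1" "H \<noteq> 0" "degree (lead_coeff H) = 0"
    for H :: "'a poly poly"
  proof
    assume "degree H = 0"
    then obtain h where "H = [:h:]"
      by (rule degree_eq_zeroE)
    moreover from this that(3) obtain f where "h = [:f:]"
      by (auto elim: degree_eq_zeroE)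
    ultimately show False
      using that by (auto simp: poly_poly_unit_iff)
  qed
  have "degree F + degree G = 3"
    using deg nz by (simp add: degree_mult_eq)
  moreover have "degree F \<noteq> 0" "degree G \<noteq> 0"
    using pos FG nz lcs by auto
  ultimately have "degree F = 1 \<or> degree G = 1"
    by linarith
  moreover have "F dvd cubic a b c d" "G dvd cubic a b c d"
    by (auto simp: FG(1))
  ultimately show ?thesis
    using linear_factor_imp_zero lcs by blast
qed

text \<open>
  The linear form vanishing at the zero divides \<open>P\<close>. The cofactor is not a unit because \<open>P\<close> is
  homogeneous of degree 3 and is thus no scalar multiple of a linear form.
\<close>

lemma zero_imp_reducible:
  assumes nz: "cubic a b c d \<noteq> 0" and z: "cubic_zero a b c d x y"
  shows "reducible (cubic a b c d)"
proof -
  have "\<exists>F. F dvd cubic a b c d \<and> \<not> F dvd 1 \<and> (\<forall>f. cubic a b c d \<noteq> F * [:[:f:]:])"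
  proof (cases "x = 0")
    case True
    then have "d = 0"
      using z by (auto simp: cubic_zero_def)
    then have "cubic a b c d = [:[:0, 1:]:] * [:[:0, 0, a:], [:0, 3 * b:], [:3 * c:]:]"
      by (simp add: cubic_pCons)
    then have "[:[:0, 1:]:] dvd cubic a b c d"
      by (metis dvd_triv_left)
    with nz show ?thesis
      by (intro exI[of _ "[:[:0, 1:]:]"]) (auto simp: cubic_pCons poly_poly_unit_iff)
  next
    case False
    define r where "r = y / x"
    have "a + 3 * b * r + 3 * c * r ^ 2 + d * r ^ 3
      = (a * x ^ 3 + 3 * b * x ^ 2 * y + 3 * c * x * y ^ 2 + d * y ^ 3) / x ^ 3"
      using False by (simp add: r_def field_simps power3_eq_cube power2_eq_square)
    then have "a + 3 * b * r + 3 * c * r ^ 2 + d * r ^ 3 = 0"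
      using z by (simp add: cubic_zero_def)
    then have "poly (cubic a b c d) [:0, r:] = 0"
      by (simp add: cubic_pCons algebra_simps power3_eq_cube power2_eq_square)
    then have "[:- [:0, r:], 1:] dvd cubic a b c d"
      by (simp add: poly_eq_0_iff_dvd)
    moreover have "\<not> [:- [:0, r:], 1:] dvd 1"
      unfolding poly_poly_unit_iff by auto
    ultimately show ?thesis
      using nz by (intro exI[of _ "[:- [:0, r:], 1:]"]) (auto simp: cubic_pCons)
  qed
  then obtain F G where F: "cubic a b c d = F * G" "\<not> F dvd 1"
      "\<And>f. cubic a b c d \<noteq> F * [:[:f:]:]"
    by (metis dvdE)
  then have "\<not> G dvd 1"
    unfolding poly_poly_unit_iff by blast
  with F nz show ?thesis
    unfolding reducible_def irreducible_def by (metis dvd_mult_left)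
qed

lemma reducible_iff_zero:
  "cubic a b c d \<noteq> 0 \<Longrightarrow> reducible (cubic a b c d) \<longleftrightarrow> (\<exists>x y. cubic_zero a b c d x y)"
  using reducible_imp_zero zero_imp_reducible by blast


section \<open>Conjugation in a quadratic extension\<close>

locale quadratic_ext =
  fixes \<iota> :: "'k::field \<Rightarrow> 'l::field"
  assumes char_neq_2: "CHAR('k) \<noteq> 2" and char_neq_3: "CHAR('k) \<noteq> 3"
    and quadratic: "quadratic_extension \<iota>"
begin

lemma emb_1 [simp]: "\<iota> 1 = 1"
  and emb_add [simp]: "\<iota> (a + b) = \<iota> a + \<iota> b"
  and emb_mult [simp]: "\<iota> (a * b) = \<iota> a * \<iota> b"
  using quadratic by (auto simp: quadratic_extension_def)

lemma emb_0 [simp]: "\<iota> 0 = 0"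
proof -
  have "\<iota> 0 + \<iota> 0 = \<iota> 0 + 0"
    by (simp flip: emb_add)
  then show ?thesis
    by (rule add_left_imp_eq)
qed

lemma emb_minus [simp]: "\<iota> (- a) = - \<iota> a"
  using emb_add[of a "- a"] by (simp add: eq_neg_iff_add_eq_0 add.commute)

lemma emb_diff [simp]: "\<iota> (a - b) = \<iota> a - \<iota> b"
  using emb_add[of a "- b"] by simp

lemma emb_power [simp]: "\<iota> (a ^ n) = \<iota> a ^ n"
  by (induction n) simp_all

lemma emb_numeral [simp]: "\<iota> (numeral n) = numeral n"
  by (induction n) (simp_all only: numeral.simps emb_1 emb_add)

lemma emb_eq_0_iff [simp]: "\<iota> a = 0 \<longleftrightarrow> a = 0"
proof
  assume "\<iota> a = 0"
  then have "\<iota> (a * inverse a) = 0"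
    by simp
  then show "a = 0"
    by (cases "a = 0") auto
qed simp

lemma emb_eq_iff [simp]: "\<iota> a = \<iota> b \<longleftrightarrow> a = b"
  using emb_eq_0_iff[of "a - b"] by simp

lemma emb_divide [simp]: "\<iota> (a / b) = \<iota> a / \<iota> b"
proof (cases "b = 0")
  case False
  then have "\<iota> (a / b) * \<iota> b = \<iota> a"
    by (simp flip: emb_mult)
  with False show ?thesis
    by (simp add: field_simps)
qed simp

lemma two_neq_0: "(2 :: 'k) \<noteq> 0" and three_neq_0: "(3 :: 'k) \<noteq> 0"
proof -
  have prime_case: "(of_nat p :: 'k) \<noteq> 0" if "CHAR('k) \<noteq> p" "prime p" for p
    using that by (auto simp: of_nat_eq_0_iff_char_dvd prime_nat_iff)
  show "(2 :: 'k) \<noteq> 0" "(3 :: 'k) \<noteq> 0"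
    using prime_case[OF char_neq_2] prime_case[OF char_neq_3] by simp_all
qed

lemma two_neq_0_ext [simp]: "(2 :: 'l) \<noteq> 0" and three_neq_0_ext [simp]: "(3 :: 'l) \<noteq> 0"
  using two_neq_0 three_neq_0 emb_eq_0_iff[of 2] emb_eq_0_iff[of 3] by simp_all

text \<open>
  Since 2 is invertible, completing the square in the quadratic equation of any generator makes the
  generator a square root of an element of the small field.
\<close>

lemma basis_with_square:
  obtains \<theta> D where "\<theta> ^ 2 = \<iota> D" "\<theta> \<notin> range \<iota>" "\<And>z. \<exists>a b. z = \<iota> a + \<iota> b * \<theta>"
proof -
  interpret vs: vector_space "\<lambda>c z. \<iota> c * z"
    by unfold_locales (simp_all add: algebra_simps)
  have "vs.independent {1}"
    by (simp add: vs.dependent_single)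
  then obtain B where B: "{1} \<subseteq> B" "vs.independent B" "UNIV \<subseteq> vs.span B"
    using vs.maximal_independent_subset_extend[of "{1}" UNIV] by auto
  have "card B = 2"
    using vs.basis_card_eq_dim[OF _ B(3,2)] quadratic by (simp add: quadratic_extension_def)
  with B(1) obtain e where e: "B = {e, 1}" "e \<noteq> 1"
    by (auto simp: card_2_iff)
  have e_notin: "e \<notin> range \<iota>"
    using B(2) e by (auto simp: vs.independent_insert vs.span_singleton)
  have span: "\<exists>a b. z = \<iota> a + \<iota> b * e" for z
  proof -
    have "z \<in> vs.span {e, 1}"
      using B(3) e by auto
    then obtain b a where "z - \<iota> b * e = \<iota> a"
      by (auto simp: vs.span_breakdown_eq)
    then show ?thesis
      by (metis add.commute diff_add_cancel)
  qed
  then obtain u v where uv: "e ^ 2 = \<iota> u + \<iota> v * e"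
    by blast
  define h where "h = v / 2"
  define \<theta> where "\<theta> = e - \<iota> h"
  have "v = 2 * h"
    using two_neq_0 by (simp add: h_def)
  with uv have "\<theta> ^ 2 = \<iota> (u + h ^ 2)"
    by (simp add: \<theta>_def power2_eq_square algebra_simps)
  moreover have "\<theta> \<notin> range \<iota>"
  proof
    assume "\<theta> \<in> range \<iota>"
    then obtain a where "e = \<iota> (a + h)"
      unfolding \<theta>_def by (auto simp: algebra_simps)
    with e_notin show False
      by blast
  qed
  moreover have "\<exists>a b. z = \<iota> a + \<iota> b * \<theta>" for z
  proof -
    obtain a b where "z = \<iota> a + \<iota> b * e"
      using span by blast
    then have "z = \<iota> (a + b * h) + \<iota> b * \<theta>"
      by (simp add: \<theta>_def algebra_simps)
    then show ?thesis
      by blast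
  qed
  ultimately show ?thesis
    using that by blast
qed

text \<open>
  An automorphism fixing the small field is determined by the image of \<open>\<theta>\<close>, which has to be one of
  the two square roots \<open>\<plusminus>\<theta>\<close> of \<open>\<theta>\<^sup>2\<close>.
\<close>

lemma gal_conj_basis:
  obtains \<theta> where "\<theta> \<noteq> 0" "\<And>z. \<exists>a b. z = \<iota> a + \<iota> b * \<theta>"
    "\<And>a b. gal_conj \<iota> (\<iota> a + \<iota> b * \<theta>) = \<iota> a - \<iota> b * \<theta>"
    "gal_conj \<iota> \<in> galois_group \<iota>"
proof -
  obtain \<theta> D where \<theta>: "\<theta> ^ 2 = \<iota> D" "\<theta> \<notin> range \<iota>" and span: "\<And>z. \<exists>a b. z = \<iota> a + \<iota> b * \<theta>"
    using basis_with_square by metis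
  have \<theta>0: "\<theta> \<noteq> 0"
    using \<theta>(2) emb_0 by (metis rangeI)
  have b0: "b = 0" if "\<iota> a + \<iota> b * \<theta> = 0" for a b
  proof (rule ccontr)
    assume "b \<noteq> 0"
    with that have "\<theta> = \<iota> (- a / b)"
      by (simp add: field_simps eq_neg_iff_add_eq_0)
    with \<theta>(2) show False
      by blast
  qed
  have uniq: "a = a' \<and> b = b'" if "\<iota> a + \<iota> b * \<theta> = \<iota> a' + \<iota> b' * \<theta>" for a b a' b'
  proof -
    have "\<iota> (a - a') + \<iota> (b - b') * \<theta> = 0"
      using that by (simp add: algebra_simps)
    with b0 have "b - b' = 0"
      by blast
    with that show ?thesis
      by simp
  qed
  define \<sigma> where "\<sigma> z = (THE w. \<exists>a b. z = \<iota> a + \<iota> b * \<theta> \<and> w = \<iota> a - \<iota> b * \<theta>)" for z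
  have \<sigma>: "\<sigma> (\<iota> a + \<iota> b * \<theta>) = \<iota> a - \<iota> b * \<theta>" for a b
    unfolding \<sigma>_def by (rule the_equality) (auto dest: uniq)
  have \<sigma>_invol: "\<sigma> (\<sigma> z) = z" for z
  proof -
    obtain a b where z: "z = \<iota> a + \<iota> b * \<theta>"
      using span by blast
    show ?thesis
      using \<sigma>[of a "- b"] by (simp add: z \<sigma>)
  qed
  have "bij \<sigma>"
    by (rule involuntory_imp_bij) (rule \<sigma>_invol)
  moreover have "\<sigma> (z + w) = \<sigma> z + \<sigma> w \<and> \<sigma> (z * w) = \<sigma> z * \<sigma> w" for z w
  proof -
    obtain a b a' b' where zw: "z = \<iota> a + \<iota> b * \<theta>" "w = \<iota> a' + \<iota> b' * \<theta>"
      using span by metis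
    have "z + w = \<iota> (a + a') + \<iota> (b + b') * \<theta>"
      by (simp add: zw algebra_simps)
    then have "\<sigma> (z + w) = \<iota> (a + a') - \<iota> (b + b') * \<theta>"
      by (simp only: \<sigma>)
    moreover have "z * w = \<iota> (a * a' + b * b' * D) + \<iota> (a * b' + b * a') * \<theta>"
      by (simp add: zw algebra_simps power2_eq_square flip: \<theta>(1))
    then have "\<sigma> (z * w) = \<iota> (a * a' + b * b' * D) - \<iota> (a * b' + b * a') * \<theta>"
      by (simp only: \<sigma>)
    ultimately show ?thesis
      unfolding zw \<sigma> by (simp add: algebra_simps power2_eq_square flip: \<theta>(1))
  qed
  moreover have "\<sigma> (\<iota> c) = \<iota> c" for c
    using \<sigma>[of c 0] by simp
  ultimately have gal: "\<sigma> \<in> galois_group \<iota>"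
    by (simp add: galois_group_def)
  have "\<sigma> \<theta> = - \<theta>"
    using \<sigma>[of 0 1] by simp
  moreover have "\<theta> \<noteq> - \<theta>"
  proof
    assume "\<theta> = - \<theta>"
    then have "2 * \<theta> = 0"
      by (metis add.right_inverse mult_2)
    with \<theta>0 show False
      by simp
  qed
  ultimately have nid: "\<sigma> \<noteq> id"
    by auto
  have "\<tau> = \<sigma>" if \<tau>: "\<tau> \<in> galois_group \<iota>" "\<tau> \<noteq> id" for \<tau>
  proof -
    have h: "\<tau> (\<iota> a + \<iota> b * \<theta>) = \<iota> a + \<iota> b * \<tau> \<theta>" for a b
      using \<tau>(1) by (simp add: galois_group_def)
    have "\<tau> \<theta> * \<tau> \<theta> = \<tau> (\<theta> * \<theta>)"
      using \<tau>(1) by (simp add: galois_group_def)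
    also have "\<dots> = \<theta> * \<theta>"
      using \<tau>(1) \<theta>(1) by (simp add: galois_group_def power2_eq_square)
    finally have "\<tau> \<theta> = \<theta> \<or> \<tau> \<theta> = - \<theta>"
      by (simp add: square_eq_iff)
    moreover have "\<tau> \<theta> \<noteq> \<theta>"
    proof
      assume t: "\<tau> \<theta> = \<theta>"
      have "\<tau> z = z" for z
        using span[of z] h t by auto
      with \<tau>(2) show False
        by auto
    qed
    ultimately have "\<tau> z = \<sigma> z" for z
      using span[of z] h \<sigma> by auto
    then show ?thesis ..
  qed
  then have "gal_conj \<iota> = \<sigma>"
    unfolding gal_conj_def using gal nid by (intro the_equality conjI) (blast | metis)+
  with that[of \<theta>] \<theta>0 span \<sigma> gal show ?thesis
    by simp
qed

abbreviation bar :: "'l \<Rightarrow> 'l" where "bar \<equiv> gal_conj \<iota>"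

lemma bar_add [simp]: "bar (z + w) = bar z + bar w"
  and bar_mult [simp]: "bar (z * w) = bar z * bar w"
  and bar_emb [simp]: "bar (\<iota> c) = \<iota> c"
  using gal_conj_basis unfolding galois_group_def by blast+

lemma bar_bar [simp]: "bar (bar z) = z"
proof -
  obtain \<theta> where span: "\<And>z. \<exists>a b. z = \<iota> a + \<iota> b * \<theta>"
    and bar: "\<And>a b. bar (\<iota> a + \<iota> b * \<theta>) = \<iota> a - \<iota> b * \<theta>"
    using gal_conj_basis by metis
  obtain a b where z: "z = \<iota> a + \<iota> b * \<theta>"
    using span by blast
  then have "bar z = \<iota> a + \<iota> (- b) * \<theta>"
    using bar[of a b] by simp
  with z bar[of a "- b"] show ?thesis
    by simp
qed

lemma bar_fixed_imp_emb:
  assumes "bar z = z"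
  obtains a where "z = \<iota> a"
proof -
  obtain \<theta> where \<theta>: "\<theta> \<noteq> 0" and span: "\<And>z. \<exists>a b. z = \<iota> a + \<iota> b * \<theta>"
    and bar: "\<And>a b. bar (\<iota> a + \<iota> b * \<theta>) = \<iota> a - \<iota> b * \<theta>"
    using gal_conj_basis by metis
  obtain a b where z: "z = \<iota> a + \<iota> b * \<theta>"
    using span by blast
  with assms bar[of a b] have "\<iota> b * \<theta> + \<iota> b * \<theta> = 0"
    by (metis add_diff_cancel_left' diff_diff_eq2 diff_self add_diff_eq)
  then have "2 * (\<iota> b * \<theta>) = 0"
    by (simp only: mult_2)
  with \<theta> have "b = 0"
    by simp
  with z that show ?thesis
    by simp
qed

lemma imaginary_exists: obtains \<theta> where "\<theta> \<noteq> 0" "bar \<theta> = - \<theta>"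
proof -
  obtain \<theta> where "\<theta> \<noteq> 0" "\<And>a b. bar (\<iota> a + \<iota> b * \<theta>) = \<iota> a - \<iota> b * \<theta>"
    using gal_conj_basis by metis
  from this(1) this(2)[of 0 1] that show ?thesis
    by simp
qed

lemma bar_0 [simp]: "bar 0 = 0" and bar_1 [simp]: "bar 1 = 1"
  using bar_emb[of 0] bar_emb[of 1] by simp_all

lemma bar_minus [simp]: "bar (- z) = - bar z"
  using bar_add[of z "- z"] by (simp add: eq_neg_iff_add_eq_0 add.commute)

lemma bar_diff [simp]: "bar (z - w) = bar z - bar w"
  using bar_add[of z "- w"] by simp

lemma bar_power [simp]: "bar (z ^ n) = bar z ^ n"
  by (induction n) simp_all

lemma bar_numeral [simp]: "bar (numeral n) = numeral n"
  using bar_emb[of "numeral n"] by simp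

lemma bar_eq_iff [simp]: "bar z = bar w \<longleftrightarrow> z = w"
  by (metis bar_bar)

lemma bar_eq_0_iff [simp]: "bar z = 0 \<longleftrightarrow> z = 0"
  using bar_eq_iff[of z 0] by simp

lemma bar_divide [simp]: "bar (z / w) = bar z / bar w"
proof (cases "w = 0")
  case False
  then have "bar (z / w) * bar w = bar z"
    by (simp flip: bar_mult)
  with False show ?thesis
    by (simp add: field_simps)
qed simp

lemma neq_minus_self: "z \<noteq> 0 \<Longrightarrow> z \<noteq> - (z :: 'l)"
  by (metis add.right_inverse mult_2 mult_eq_0_iff two_neq_0_ext)

text \<open>
  Hilbert's theorem 90, with the witness \<open>s = 1 + z\<close>. It vanishes only for \<open>z = - 1\<close>, where any nonzero
  imaginary element serves instead.
\<close>

lemma hilbert_90: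
  assumes "z * bar z = 1"
  obtains s where "s \<noteq> 0" "z * bar s = s"
proof (cases "z = - 1")
  case True
  obtain \<theta> where "\<theta> \<noteq> 0" "bar \<theta> = - \<theta>"
    by (rule imaginary_exists)
  with True that[of \<theta>] show ?thesis
    by simp
next
  case False
  then have "1 + z \<noteq> 0"
    by (simp add: add_eq_0_iff)
  moreover have "z * bar (1 + z) = 1 + z"
    using assms by (simp add: algebra_simps)
  ultimately show ?thesis
    using that by blast
qed

text \<open>
  If \<open>t\<^sup>3\<close> has norm 1, then the norm \<open>n\<close> of \<open>t\<close> is a cube root of unity in the small field, and
  \<open>n t\<close> has norm \<open>n\<^sup>3 = 1\<close> and the same cube as \<open>t\<close>.
\<close>

lemma norm_one_cube:
  assumes "(t * bar t) ^ 3 = 1"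
  obtains s where "s \<noteq> 0" "t ^ 3 * bar s ^ 3 = s ^ 3"
proof -
  define n where "n = t * bar t"
  have n: "n ^ 3 = 1" "bar n = n"
    using assms by (simp_all add: n_def mult.commute)
  have "(n * t) * bar (n * t) = n ^ 3"
    by (simp add: n(2)) (simp add: n_def power3_eq_cube algebra_simps)
  then obtain s where s: "s \<noteq> 0" "n * t * bar s = s"
    using n(1) hilbert_90[of "n * t"] by metis
  then have "(n * t * bar s) ^ 3 = s ^ 3"
    by simp
  then have "t ^ 3 * bar s ^ 3 = s ^ 3"
    using n(1) by (simp add: power_mult_distrib)
  with s(1) that show ?thesis
    by blast
qed

definition cvec :: "'l ^ 2 \<Rightarrow> 'l ^ 2" where
  "cvec = conj_vec \<iota>"

lemma cvec_nth [simp]: "cvec p $ i = bar (p $ i)"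
  by (simp add: cvec_def conj_vec_def)

lemma bar_wedge: "bar (wedge p (cvec p)) = - wedge p (cvec p)"
  by (simp add: wedge_def algebra_simps)

text \<open>
  A form independent of its conjugate identifies \<open>k\<^sup>2\<close> with the extension; the preimage of \<open>z\<close> is
  found by Cramer's rule from the values \<open>z\<close> and \<open>bar z\<close> of the form and its conjugate.
\<close>

lemma form_onto:
  assumes "wedge p (cvec p) \<noteq> 0"
  obtains a b where "z = p $ 1 * \<iota> a + p $ 2 * \<iota> b"
proof -
  define w where "w = wedge p (cvec p)"
  have w: "w \<noteq> 0" "bar w = - w" "w = p $ 1 * bar (p $ 2) - p $ 2 * bar (p $ 1)"
    using assms bar_wedge[of p] by (simp_all add: w_def) (simp add: wedge_def)
  obtain a where a: "(z * bar (p $ 2) - bar z * p $ 2) / w = \<iota> a"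
    by (rule bar_fixed_imp_emb[of "(z * bar (p $ 2) - bar z * p $ 2) / w"])
      (use w(1,2) in \<open>simp_all add: field_simps\<close>)
  obtain b where b: "(bar z * p $ 1 - z * bar (p $ 1)) / w = \<iota> b"
    by (rule bar_fixed_imp_emb[of "(bar z * p $ 1 - z * bar (p $ 1)) / w"])
      (use w(1,2) in \<open>simp_all add: field_simps\<close>)
  have "p $ 1 * \<iota> a + p $ 2 * \<iota> b = z * (p $ 1 * bar (p $ 2) - p $ 2 * bar (p $ 1)) / w"
    unfolding a[symmetric] b[symmetric] by (simp add: add_divide_distrib[symmetric] algebra_simps)
  also have "\<dots> = z"
    unfolding w(3)[symmetric] using w(1) by simp
  finally show ?thesis
    using that by metis
qed

end


section \<open>Cube classes\<close>

lemma comm_group_field_units: "comm_group (field_units :: 'l::field monoid)"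
proof (rule comm_groupI)
  fix x :: 'l
  assume "x \<in> carrier field_units"
  then show "\<exists>y \<in> carrier field_units. y \<otimes>\<^bsub>field_units\<^esub> x = \<one>\<^bsub>field_units\<^esub>"
    by (intro bexI[of _ "inverse x"]) (auto simp: field_units_def)
qed (auto simp: field_units_def)

lemma inv_field_units: "z \<noteq> 0 \<Longrightarrow> inv\<^bsub>field_units\<^esub> z = inverse (z :: 'l::field)"
proof -
  assume "z \<noteq> 0"
  interpret comm_group "field_units :: 'l monoid"
    by (rule comm_group_field_units)
  show ?thesis
    using \<open>z \<noteq> 0\<close> by (intro inv_equality) (auto simp: field_units_def)
qed

lemma subgroup_unit_cubes: "subgroup (unit_cubes :: 'l::field set) field_units"
proof -
  interpret comm_group "field_units :: 'l monoid"
    by (rule comm_group_field_units)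
  show ?thesis
  proof (rule subgroupI)
    show "unit_cubes \<noteq> ({} :: 'l set)"
      by (auto simp: unit_cubes_def intro!: exI[of _ 1])
  next
    fix z :: 'l
    assume "z \<in> unit_cubes"
    then obtain w where "w \<noteq> 0" "z = w ^ 3"
      by (auto simp: unit_cubes_def)
    then show "inv\<^bsub>field_units\<^esub> z \<in> unit_cubes"
      by (auto simp: inv_field_units unit_cubes_def power_inverse intro!: exI[of _ "inverse w"])
  next
    fix z w :: 'l
    assume "z \<in> unit_cubes" "w \<in> unit_cubes"
    then show "z \<otimes>\<^bsub>field_units\<^esub> w \<in> unit_cubes"
      by (auto simp: unit_cubes_def field_units_def simp flip: power_mult_distrib)
  qed (auto simp: unit_cubes_def field_units_def)
qed

lemma normal_unit_cubes: "unit_cubes \<lhd> field_units"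
  by (rule comm_group.subgroup_imp_normal[OF comm_group_field_units subgroup_unit_cubes])

lemma comm_group_cube_classes: "comm_group cube_classes"
  unfolding cube_classes_def
  by (rule comm_group.abelian_FactGroup[OF comm_group_field_units subgroup_unit_cubes])

lemma cube_class_eq_image: "cube_class z = (\<lambda>t. t ^ 3 * z) ` (UNIV - {0})"
  by (auto simp: cube_class_def r_coset_def unit_cubes_def field_units_def)

lemma cube_class_eq_iff:
  fixes z w :: "'l::field"
  shows "cube_class z = cube_class w \<longleftrightarrow> (\<exists>t. t \<noteq> 0 \<and> z = t ^ 3 * w)"
proof
  assume "cube_class z = cube_class w"
  moreover have "z \<in> cube_class z"
    by (auto simp: cube_class_eq_image intro!: image_eqI[of _ _ 1])
  ultimately show "\<exists>t. t \<noteq> 0 \<and> z = t ^ 3 * w"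
    by (auto simp: cube_class_eq_image)
next
  assume "\<exists>t. t \<noteq> 0 \<and> z = t ^ 3 * w"
  then obtain t where t: "t \<noteq> 0" "z = t ^ 3 * w"
    by blast
  have "s ^ 3 * z \<in> cube_class w" if "s \<noteq> 0" for s
    using t that by (auto simp: cube_class_eq_image power_mult_distrib intro!: image_eqI[of _ _ "s * t"])
  moreover have "s ^ 3 * w \<in> cube_class z" if "s \<noteq> 0" for s
    using t that by (auto simp: cube_class_eq_image power_divide intro!: image_eqI[of _ _ "s / t"])
  ultimately show "cube_class z = cube_class w"
    by (auto simp: cube_class_eq_image[of z] cube_class_eq_image[of w])
qed

lemma carrier_cube_classes: "carrier cube_classes = cube_class ` (UNIV - {0})"
  by (auto simp: cube_classes_def carrier_FactGroup field_units_def cube_class_def)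

lemma cube_class_mult:
  "z \<noteq> 0 \<Longrightarrow> w \<noteq> 0 \<Longrightarrow> cube_class z \<otimes>\<^bsub>cube_classes\<^esub> cube_class w = cube_class (z * w)"
  using normal.rcos_sum[OF normal_unit_cubes, of z w]
  by (simp add: cube_classes_def cube_class_def field_units_def)

lemma cube_class_one: "\<one>\<^bsub>cube_classes\<^esub> = cube_class 1"
  by (auto simp: cube_classes_def cube_class_eq_image unit_cubes_def)

lemma cube_class_inv:
  fixes z :: "'l::field"
  assumes "z \<noteq> 0"
  shows "inv\<^bsub>cube_classes\<^esub> (cube_class z) = cube_class (inverse z)"
proof -
  interpret comm_group "cube_classes :: 'l set monoid"
    by (rule comm_group_cube_classes)
  show ?thesis
    using assms by (intro inv_equality) (auto simp: cube_class_mult cube_class_one carrier_cube_classes)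
qed

lemma Z2_class_eq_iff:
  assumes "q \<noteq> - q"
  shows "Z2_class q u = Z2_class q v \<longleftrightarrow> u = v"
  using assms by (auto simp: Z2_class_def doubleton_eq_iff)

lemma Z2_class_swap:
  fixes u :: "'l::field set"
  assumes "u \<in> carrier cube_classes"
  shows "Z2_class (- q) (inv\<^bsub>cube_classes\<^esub> u) = Z2_class q u"
proof -
  interpret comm_group "cube_classes :: 'l set monoid"
    by (rule comm_group_cube_classes)
  show ?thesis
    using assms by (auto simp: Z2_class_def)
qed

lemma sq_hat_Z2_class: "sq_hat (Z2_class q u) = q ^ 2"
  by (simp add: sq_hat_def Z2_class_def)

section \<open>The fibres of the squaring map\<close>

context quadratic_ext
begin

lemma bar_cube_class: "bar ` cube_class z = cube_class (bar z)"
proof -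
  have "\<exists>s. s \<noteq> 0 \<and> t = bar s" if "t \<noteq> 0" for t
    using that by (intro exI[of _ "bar t"]) simp
  then show ?thesis
    by (fastforce simp: cube_class_eq_image image_image image_iff)
qed

lemma carrier_U_group:
  "carrier (U_group \<iota>) = cube_class ` {z. z \<noteq> 0 \<and> (\<exists>t. t \<noteq> 0 \<and> z * bar z = t ^ 3)}"
proof -
  have "cube_class z \<otimes>\<^bsub>cube_classes\<^esub> bar ` cube_class z = \<one>\<^bsub>cube_classes\<^esub>
      \<longleftrightarrow> (\<exists>t. t \<noteq> 0 \<and> z * bar z = t ^ 3)" if "z \<noteq> 0" for z
    using that by (simp add: bar_cube_class cube_class_mult cube_class_one cube_class_eq_iff)
  then show ?thesis
    by (auto simp: U_group_def carrier_cube_classes)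
qed

lemma carrier_U_group_subset: "carrier (U_group \<iota>) \<subseteq> carrier cube_classes"
  by (auto simp: U_group_def)

lemma subgroup_U_group: "subgroup (carrier (U_group \<iota>)) cube_classes"
proof -
  interpret comm_group "cube_classes :: 'l set monoid"
    by (rule comm_group_cube_classes)
  show ?thesis
  proof (rule subgroupI)
    have "cube_class 1 \<in> carrier (U_group \<iota>)"
      by (auto simp: carrier_U_group intro!: imageI exI[of _ 1])
    then show "carrier (U_group \<iota>) \<noteq> {}"
      by blast
  next
    fix u
    assume "u \<in> carrier (U_group \<iota>)"
    then obtain z t where "u = cube_class z" "z \<noteq> 0" "t \<noteq> 0" "z * bar z = t ^ 3"
      by (auto simp: carrier_U_group)
    moreover from this have "inverse z * bar (inverse z) = inverse t ^ 3"
      using bar_divide[of 1 z] by (simp add: power_inverse divide_inverse flip: inverse_mult_distrib)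
    ultimately show "inv\<^bsub>cube_classes\<^esub> u \<in> carrier (U_group \<iota>)"
      by (auto simp: carrier_U_group cube_class_inv intro!: imageI exI[of _ "inverse t"])
  next
    fix u v
    assume "u \<in> carrier (U_group \<iota>)" "v \<in> carrier (U_group \<iota>)"
    then obtain z t w s where "u = cube_class z" "z \<noteq> 0" "t \<noteq> 0" "z * bar z = t ^ 3"
        "v = cube_class w" "w \<noteq> 0" "s \<noteq> 0" "w * bar w = s ^ 3"
      by (auto simp: carrier_U_group)
    moreover from this have "(z * w) * bar (z * w) = (t * s) ^ 3"
      by (simp add: power_mult_distrib mult.commute mult.left_commute)
    ultimately show "u \<otimes>\<^bsub>cube_classes\<^esub> v \<in> carrier (U_group \<iota>)"
      unfolding carrier_U_group by (auto simp: cube_class_mult intro!: imageI exI[of _ "t * s"])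
  qed (rule carrier_U_group_subset)
qed

lemma U_group_eq: "U_group \<iota> = cube_classes\<lparr>carrier := carrier (U_group \<iota>)\<rparr>"
  by (simp add: U_group_def)

lemma group_U_group: "group (U_group \<iota>)"
  by (subst U_group_eq)
    (rule subgroup.subgroup_is_group[OF subgroup_U_group comm_group.axioms(2)[OF comm_group_cube_classes]])

lemma mult_U_group: "u \<otimes>\<^bsub>U_group \<iota>\<^esub> v = u \<otimes>\<^bsub>cube_classes\<^esub> v"
  and one_U_group: "\<one>\<^bsub>U_group \<iota>\<^esub> = cube_class 1"
  by (simp_all add: U_group_def cube_class_one)

lemma Im_starD: "q \<in> Im_star \<iota> \<Longrightarrow> bar q = - q \<and> q \<noteq> 0"
  by (simp add: Im_star_def)

text \<open>
  A class over \<open>M\<close> has a representative with first component \<open>q\<close>: the only other square root of \<open>M\<close> is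
  \<open>- q\<close>, and the \<open>Z\<^sub>2\<close>-action exchanges the two.
\<close>

lemma carrier_sq_fibre:
  assumes q: "q \<in> Im_star \<iota>" "q ^ 2 = M"
  shows "carrier (sq_fibre \<iota> M) = Z2_class q ` carrier (U_group \<iota>)"
proof -
  have "Z2_class p u \<in> Z2_class q ` carrier (U_group \<iota>)"
    if "p ^ 2 = M" "u \<in> carrier (U_group \<iota>)" for p u
  proof -
    have "p = q \<or> p = - q"
      using that(1) q(2) unfolding power2_eq_iff[symmetric] by simp
    then show ?thesis
    proof
      assume "p = - q"
      then have "Z2_class p u = Z2_class q (inv\<^bsub>cube_classes\<^esub> u)"
        using Z2_class_swap[of u p] that(2) carrier_U_group_subset by auto
      then show ?thesis
        using subgroup.m_inv_closed[OF subgroup_U_group that(2)] by blast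
    qed (use that in blast)
  qed
  then show ?thesis
    using q by (auto simp: sq_fibre_def Im_times_U_def sq_hat_Z2_class)
qed

text \<open>
  Replacing \<open>q\<close> by \<open>- q\<close> inverts both factors, and inversion is multiplicative because the group of
  cube classes is abelian. So the product computed with either square root is the same.
\<close>

lemma sq_fibre_mult:
  assumes q: "q \<in> Im_star \<iota>" "q ^ 2 = M"
    and uv: "u \<in> carrier (U_group \<iota>)" "v \<in> carrier (U_group \<iota>)"
  shows "Z2_class q u \<otimes>\<^bsub>sq_fibre \<iota> M\<^esub> Z2_class q v = Z2_class q (u \<otimes>\<^bsub>U_group \<iota>\<^esub> v)"
proof -
  interpret cc: comm_group "cube_classes :: 'l set monoid"
    by (rule comm_group_cube_classes)
  have ne: "q \<noteq> - q"
    using Im_starD[OF q(1)] neq_minus_self by blast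
  have "E = Z2_class q (u \<otimes>\<^bsub>U_group \<iota>\<^esub> v)"
    if p: "p ^ 2 = M" and u'v': "u' \<in> carrier (U_group \<iota>)" "v' \<in> carrier (U_group \<iota>)"
      and eq: "Z2_class q u = Z2_class p u'" "Z2_class q v = Z2_class p v'"
        "E = Z2_class p (u' \<otimes>\<^bsub>U_group \<iota>\<^esub> v')" for p u' v' E
  proof -
    have "p = q \<or> p = - q"
      using p q(2) unfolding power2_eq_iff[symmetric] by simp
    then show ?thesis
    proof
      assume "p = q"
      then show ?thesis
        using eq by (simp add: Z2_class_eq_iff[OF ne])
    next
      assume p: "p = - q"
      have in_cc: "u' \<in> carrier cube_classes" "v' \<in> carrier cube_classes"
        using u'v' carrier_U_group_subset by auto
      have "u = inv\<^bsub>cube_classes\<^esub> u'" "v = inv\<^bsub>cube_classes\<^esub> v'"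
        using eq(1,2) Z2_class_swap[of u' p] Z2_class_swap[of v' p] in_cc p
        by (simp_all add: Z2_class_eq_iff[OF ne, symmetric])
      then have "u \<otimes>\<^bsub>cube_classes\<^esub> v = inv\<^bsub>cube_classes\<^esub> (u' \<otimes>\<^bsub>cube_classes\<^esub> v')"
        using in_cc by (simp add: cc.inv_mult)
      then show ?thesis
        using eq(3) Z2_class_swap[of "u' \<otimes>\<^bsub>cube_classes\<^esub> v'" p] in_cc p by (simp add: mult_U_group)
    qed
  qed
  then show ?thesis
    using q uv unfolding sq_fibre_def monoid.simps by (intro the_equality) blast+
qed

lemma sq_fibre_one:
  assumes q: "q \<in> Im_star \<iota>" "q ^ 2 = M"
  shows "\<one>\<^bsub>sq_fibre \<iota> M\<^esub> = Z2_class q \<one>\<^bsub>U_group \<iota>\<^esub>"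
proof -
  have one: "inv\<^bsub>cube_classes\<^esub> (cube_class (1 :: 'l)) = cube_class 1"
    by (simp add: cube_class_inv)
  have "Z2_class p (cube_class 1) = Z2_class q (cube_class 1)" if "p ^ 2 = M" for p
  proof -
    have "p = q \<or> p = - q"
      using that q(2) unfolding power2_eq_iff[symmetric] by simp
    then show ?thesis
      by (auto simp: Z2_class_def one)
  qed
  then show ?thesis
    using q unfolding sq_fibre_def monoid.simps one_U_group by (intro the_equality) blast+
qed

lemma Z2_class_iso:
  assumes q: "q \<in> Im_star \<iota>" "q ^ 2 = M"
  shows "Z2_class q \<in> iso (U_group \<iota>) (sq_fibre \<iota> M)"
proof (rule isoI)
  show "Z2_class q \<in> hom (U_group \<iota>) (sq_fibre \<iota> M)"
    using q by (auto simp: hom_def carrier_sq_fibre sq_fibre_mult)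
  have "q \<noteq> - q"
    using Im_starD[OF q(1)] neq_minus_self by blast
  then show "bij_betw (Z2_class q) (carrier (U_group \<iota>)) (carrier (sq_fibre \<iota> M))"
    by (auto simp: bij_betw_def inj_on_def Z2_class_eq_iff carrier_sq_fibre[OF q])
qed

lemma group_sq_fibre:
  assumes q: "q \<in> Im_star \<iota>" "q ^ 2 = M"
  shows "group (sq_fibre \<iota> M)"
  using group.iso_imp_img_group[OF group_U_group Z2_class_iso[OF q]]
  by (simp add: sq_fibre_one[OF q, symmetric])

end

section \<open>Transport of group structure\<close>

lemma pullback_group_iso:
  assumes G: "group G" and f: "bij_betw f S (carrier G)"
  shows "f \<in> iso (pullback_group S f G) G" "group (pullback_group S f G)"
    and "\<And>a. a \<in> S \<Longrightarrow> a = \<one>\<^bsub>pullback_group S f G\<^esub> \<longleftrightarrow> f a = \<one>\<^bsub>G\<^esub>"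
proof -
  interpret group G
    by (rule G)
  have f_inv: "f (inv_into S f x) = x" if "x \<in> carrier G" for x
    using f that by (simp add: bij_betw_inv_into_right)
  have inv_f: "inv_into S f (f a) = a" if "a \<in> S" for a
    using f that by (simp add: bij_betw_inv_into_left)
  have in_carrier: "f a \<in> carrier G" if "a \<in> S" for a
    using f that by (auto simp: bij_betw_def)
  have "f \<in> hom (pullback_group S f G) G"
    by (auto simp: hom_def pullback_group_def f_inv in_carrier)
  then show iso: "f \<in> iso (pullback_group S f G) G"
    using f by (auto intro: isoI simp: pullback_group_def)
  have "inv_into S f \<in> iso G (pullback_group S f G)"
  proof (rule isoI)
    show bij: "bij_betw (inv_into S f) (carrier G) (carrier (pullback_group S f G))"
      using bij_betw_inv_into[OF f] by (simp add: pullback_group_def)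
    then have "inv_into S f x \<in> S" if "x \<in> carrier G" for x
      using that by (auto simp: bij_betw_def pullback_group_def)
    then show "inv_into S f \<in> hom G (pullback_group S f G)"
      by (auto simp: hom_def pullback_group_def f_inv)
  qed
  from iso_imp_img_group[OF this] show "group (pullback_group S f G)"
    by (simp add: pullback_group_def)
  show "a = \<one>\<^bsub>pullback_group S f G\<^esub> \<longleftrightarrow> f a = \<one>\<^bsub>G\<^esub>" if "a \<in> S" for a
    using inv_f[OF that] f_inv[OF one_closed] by (auto simp: pullback_group_def)
qed


section \<open>Splitting a cubic over the extension\<close>

text \<open>
  This is the polar trilinear form of the cubic \<open>l p\<^sup>3\<close>, evaluated at the vectors dual to \<open>x\<close>, \<open>y\<close>, \<open>z\<close> under
  the area form. The right-hand side is linear in the coordinates of the cubic, so identities between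
  sums of cubes may be tested by wedging with any three forms; wedging with one of the forms involved
  makes its term vanish.
\<close>

lemma wedge_polarisation:
  "l * wedge p x * wedge p y * wedge p z
    = l * p $ 1 ^ 3 * (x $ 2 * y $ 2 * z $ 2)
      - l * p $ 1 ^ 2 * p $ 2 * (x $ 1 * y $ 2 * z $ 2 + x $ 2 * y $ 1 * z $ 2 + x $ 2 * y $ 2 * z $ 1)
      + l * p $ 1 * p $ 2 ^ 2 * (x $ 1 * y $ 1 * z $ 2 + x $ 1 * y $ 2 * z $ 1 + x $ 2 * y $ 1 * z $ 1)
      - l * p $ 2 ^ 3 * (x $ 1 * y $ 1 * z $ 1)"
  by (simp add: wedge_def algebra_simps power2_eq_square power3_eq_cube)

lemma polarised_sums_eq:
  assumes three: "(3 :: 'a::field) \<noteq> 0"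
    and eq: "const2 l * lin_form p ^ 3 + const2 l' * lin_form p' ^ 3
      = const2 m * lin_form q ^ 3 + const2 (m' :: 'a) * lin_form q' ^ 3"
  shows "l * wedge p x * wedge p y * wedge p z + l' * wedge p' x * wedge p' y * wedge p' z
    = m * wedge q x * wedge q y * wedge q z + m' * wedge q' x * wedge q' y * wedge q' z"
proof -
  have c: "l * p $ 1 ^ 3 + l' * p' $ 1 ^ 3 = m * q $ 1 ^ 3 + m' * q' $ 1 ^ 3"
    "l * p $ 1 ^ 2 * p $ 2 + l' * p' $ 1 ^ 2 * p' $ 2 = m * q $ 1 ^ 2 * q $ 2 + m' * q' $ 1 ^ 2 * q' $ 2"
    "l * p $ 1 * p $ 2 ^ 2 + l' * p' $ 1 * p' $ 2 ^ 2 = m * q $ 1 * q $ 2 ^ 2 + m' * q' $ 1 * q' $ 2 ^ 2"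
    "l * p $ 2 ^ 3 + l' * p' $ 2 ^ 3 = m * q $ 2 ^ 3 + m' * q' $ 2 ^ 3"
    using eq unfolding scaled_cube_eq_cubic cubic_add cubic_eq_iff[OF three] by auto
  show ?thesis
    unfolding wedge_polarisation using c by algebra
qed

lemma distinct_independent_iff:
  "p \<noteq> q \<and> vec.independent {p, q} \<longleftrightarrow> wedge p q \<noteq> (0 :: 'a::field)"
proof
  assume pq: "p \<noteq> q \<and> vec.independent {p, q}"
  then have q: "q \<noteq> 0" and notin: "p \<noteq> k *s q" for k
    by (auto simp: vec.independent_insert vec.span_singleton)
  show "wedge p q \<noteq> 0"
  proof
    assume w: "wedge p q = 0"
    from q consider "q $ 1 \<noteq> 0" | "q $ 2 \<noteq> 0"
      by (auto simp: vec_eq_iff forall_2)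
    then show False
    proof cases
      case 1
      then have "p = (p $ 1 / q $ 1) *s q"
        using w by (auto simp: vec_eq_iff forall_2 wedge_def field_simps)
      with notin show False by blast
    next
      case 2
      then have "p = (p $ 2 / q $ 2) *s q"
        using w by (auto simp: vec_eq_iff forall_2 wedge_def field_simps)
      with notin show False by blast
    qed
  qed
next
  assume "wedge p q \<noteq> 0"
  moreover from this have "p \<noteq> q" "q \<noteq> 0"
    by (auto simp: wedge_def)
  ultimately show "p \<noteq> q \<and> vec.independent {p, q}"
    by (auto simp: vec.independent_insert vec.span_singleton wedge_def)
qed

text \<open>
  The Hessian of the cubic with coordinates \<open>a, b, c, d\<close> is \<open>A x\<^sup>2 + B x y + C y\<^sup>2\<close>. When its discriminant
  is \<open>q\<^sup>2\<close>, its linear factors are proportional to \<open>x - r y\<close> and \<open>x - r' y\<close>, and the four power sums below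
  say that the cubic is \<open>l (x - r y)\<^sup>3 + l' (x - r' y)\<^sup>3\<close>. The coefficients \<open>l\<close> and \<open>l'\<close> are determined by the first
  two of these equations; the other two follow, since the power sums satisfy the linear recurrence
  with characteristic polynomial \<open>A X\<^sup>2 + B X + C\<close> and so do the signed coordinates \<open>a, - b, c, - d\<close>.
\<close>

lemma hessian_roots:
  fixes a b c d q :: "'a::field"
  defines "A \<equiv> a * c - b ^ 2" and "B \<equiv> a * d - b * c" and "C \<equiv> b * d - c ^ 2"
  defines "T \<equiv> a * B - 2 * b * A"
  defines "r \<equiv> (q - B) / (2 * A)" and "r' \<equiv> (- q - B) / (2 * A)"
  defines "l \<equiv> (a * q + T) / (2 * q)" and "l' \<equiv> (a * q - T) / (2 * q)"
  assumes nz: "A \<noteq> 0" "q \<noteq> 0" "(2 :: 'a) \<noteq> 0" and disc: "q ^ 2 = B ^ 2 - 4 * A * C"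
  shows "l + l' = a" "l * r + l' * r' = - b" "l * r ^ 2 + l' * r' ^ 2 = c"
    "l * r ^ 3 + l' * r' ^ 3 = - d" "r - r' = q / A"
proof -
  have "(4 :: 'a) = 2 * 2"
    by simp
  with nz have four: "(4 :: 'a) \<noteq> 0"
    by (metis mult_eq_0_iff)
  have r: "2 * A * r = q - B" "2 * A * r' = - q - B" and l: "2 * q * l = a * q + T" "2 * q * l' = a * q - T"
    using nz by (simp_all add: r_def r'_def l_def l'_def)
  have "2 * q * (l + l') = 2 * q * a"
    using l by (simp add: algebra_simps)
  then show s0: "l + l' = a"
    using nz by simp
  have "4 * A * q * (l * r + l' * r') = (2 * q * l) * (2 * A * r) + (2 * q * l') * (2 * A * r')"
    by (simp add: algebra_simps)
  also have "\<dots> = 4 * A * q * (- b)"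
    unfolding r l T_def by (simp add: algebra_simps)
  finally show s1: "l * r + l' * r' = - b"
    using nz four by (metis mult_cancel_left mult_eq_0_iff)
  have "4 * A * (A * r ^ 2 + B * r + C) = (2 * A * r) ^ 2 + 2 * B * (2 * A * r) + 4 * A * C"
    "4 * A * (A * r' ^ 2 + B * r' + C) = (2 * A * r') ^ 2 + 2 * B * (2 * A * r') + 4 * A * C"
    by (simp_all add: algebra_simps power2_eq_square)
  moreover have "(q - B) ^ 2 + 2 * B * (q - B) + 4 * A * C = 0"
    "(- q - B) ^ 2 + 2 * B * (- q - B) + 4 * A * C = 0"
    using disc by (simp_all add: algebra_simps power2_eq_square)
  ultimately have "4 * A * (A * r ^ 2 + B * r + C) = 0" "4 * A * (A * r' ^ 2 + B * r' + C) = 0"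
    unfolding r by simp_all
  then have "A * r ^ 2 + B * r + C = 0" "A * r' ^ 2 + B * r' + C = 0"
    using nz four by simp_all
  then have quad: "A * r ^ 2 = - B * r - C" "A * r' ^ 2 = - B * r' - C"
    by (simp_all add: algebra_simps eq_neg_iff_add_eq_0)
  have "A * (l * r ^ 2 + l' * r' ^ 2) = l * (A * r ^ 2) + l' * (A * r' ^ 2)"
    by (simp add: algebra_simps)
  also have "\<dots> = - B * (l * r + l' * r') - C * (l + l')"
    unfolding quad by (simp add: algebra_simps)
  also have "\<dots> = A * c"
    unfolding s0 s1 A_def B_def C_def by (simp add: algebra_simps power2_eq_square)
  finally show s2: "l * r ^ 2 + l' * r' ^ 2 = c"
    using nz by simp
  have "A * (l * r ^ 3 + l' * r' ^ 3) = l * r * (A * r ^ 2) + l' * r' * (A * r' ^ 2)"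
    by (simp add: algebra_simps power2_eq_square power3_eq_cube)
  also have "\<dots> = - B * (l * r ^ 2 + l' * r' ^ 2) - C * (l * r + l' * r')"
    unfolding quad by (simp add: algebra_simps power2_eq_square)
  also have "\<dots> = A * (- d)"
    unfolding s1 s2 A_def B_def C_def by (simp add: algebra_simps power2_eq_square)
  finally show "l * r ^ 3 + l' * r' ^ 3 = - d"
    using nz by (metis mult_cancel_left)
  have "2 * A * (r - r') = 2 * A * r - 2 * A * r'"
    by (simp add: algebra_simps)
  then have "2 * A * (r - r') = 2 * q"
    unfolding r by simp
  then have "2 * (A * (r - r')) = 2 * q"
    by (simp only: mult.assoc)
  then have "A * (r - r') = q"
    using nz by (metis mult_cancel_left)
  then show "r - r' = q / A"
    using nz by (metis nonzero_mult_div_cancel_left)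
qed

context quadratic_ext
begin

lemma base_ext_cubic: "base_ext \<iota> (cubic a b c d) = cubic (\<iota> a) (\<iota> b) (\<iota> c) (\<iota> d)"
  by (simp add: base_ext_def cubic_pCons map_poly_pCons)

lemma Qn_base_ext: "P \<in> binary_cubics \<Longrightarrow> Qn (base_ext \<iota> P) = \<iota> (Qn P)"
  by (auto simp: binary_cubics_def base_ext_cubic Qn_def cubic_coordinates three_neq_0)

lemma base_ext_inject:
  "P \<in> binary_cubics \<Longrightarrow> P' \<in> binary_cubics \<Longrightarrow> base_ext \<iota> P = base_ext \<iota> P' \<Longrightarrow> P = P'"
  by (auto simp: binary_cubics_def base_ext_cubic cubic_eq_iff)

lemma is_decomposition_iff:
  "is_decomposition \<iota> P l p \<longleftrightarrow> l \<noteq> 0 \<and> wedge p (cvec p) \<noteq> 0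
    \<and> base_ext \<iota> P = const2 l * lin_form p ^ 3 + const2 (bar l) * lin_form (cvec p) ^ 3"
  using distinct_independent_iff[of p "cvec p"] by (auto simp: is_decomposition_def cvec_def)

lemma is_decomposition_cubic_iff:
  "is_decomposition \<iota> (cubic a b c d) l p \<longleftrightarrow> l \<noteq> 0 \<and> wedge p (cvec p) \<noteq> 0
    \<and> \<iota> a = l * p $ 1 ^ 3 + bar l * bar (p $ 1) ^ 3
    \<and> \<iota> b = l * p $ 1 ^ 2 * p $ 2 + bar l * bar (p $ 1) ^ 2 * bar (p $ 2)
    \<and> \<iota> c = l * p $ 1 * p $ 2 ^ 2 + bar l * bar (p $ 1) * bar (p $ 2) ^ 2
    \<and> \<iota> d = l * p $ 2 ^ 3 + bar l * bar (p $ 2) ^ 3"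
  unfolding is_decomposition_iff base_ext_cubic scaled_cube_eq_cubic cubic_add
    cubic_eq_iff[OF three_neq_0_ext] cvec_nth by blast

text \<open>
  The value of \<open>omega\<close> on the ordered pair of conjugate summands \<open>l p\<^sup>3\<close> and \<open>bar l (cvec p)\<^sup>3\<close>, by
  \<open>omega_scaled_cubes\<close>.
\<close>

definition omega_summands :: "'l \<Rightarrow> 'l ^ 2 \<Rightarrow> 'l" where
  "omega_summands l p = l * bar l * wedge p (cvec p) ^ 3"

lemma Qn_decomposition:
  "P \<in> binary_cubics \<Longrightarrow> is_decomposition \<iota> P l p \<Longrightarrow> \<iota> (Qn P) = omega_summands l p ^ 2"
  using Qn_base_ext[of P] Qn_sum_of_scaled_cubes[OF three_neq_0_ext, of l p "bar l" "cvec p"]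
  by (simp add: is_decomposition_iff omega_summands_def)

lemma omega_summands_Im_star:
  assumes "is_decomposition \<iota> P l p"
  shows "omega_summands l p \<in> Im_star \<iota>"
  using assms bar_wedge[of p]
  by (simp add: is_decomposition_iff omega_summands_def Im_star_def mult.commute)

text \<open>
  Conjugation sends \<open>q\<close> to \<open>- q\<close> and therefore interchanges the two roots of the Hessian and the two
  coefficients in \<open>hessian_roots\<close>.
\<close>

lemma decomposition_exists:
  assumes "P \<in> O_hat \<iota>"
  obtains l p where "is_decomposition \<iota> P l p"
proof -
  obtain a b c d q where P: "P = cubic a b c d" and q: "q \<in> Im_star \<iota>" "\<iota> (Qn P) = q ^ 2"
    using assms by (auto simp: O_hat_def binary_cubics_def Im_star_sq_def)
  note bar_q = Im_starD[OF q(1)]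
  define A B C where "A = a * c - b ^ 2" and "B = a * d - b * c" and "C = b * d - c ^ 2"
  have Q: "Qn P = B ^ 2 - 4 * A * C"
    unfolding P Qn_def cubic_coordinates[OF three_neq_0] A_def B_def C_def
    by (simp add: algebra_simps power2_eq_square power3_eq_cube)
  \<comment> \<open>If \<open>A\<close> vanished, the discriminant would be a square in the small field, and \<open>q\<close> would lie there.\<close>
  have A: "A \<noteq> 0"
  proof
    assume "A = 0"
    then have "q ^ 2 = \<iota> B ^ 2"
      using q(2) Q by simp
    then have "q = \<iota> B \<or> q = \<iota> (- B)"
      by (simp add: power2_eq_iff)
    then have "bar q = q"
      by (metis bar_emb)
    then show False
      using bar_q neq_minus_self by metis
  qed
  define T where "T = \<iota> (a * B - 2 * b * A)"
  define r where "r = (q - \<iota> B) / (2 * \<iota> A)"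
  define l where "l = (\<iota> a * q + T) / (2 * q)"
  define p :: "'l ^ 2" where "p = (\<chi> i. if i = 1 then 1 else - r)"
  have p: "p $ 1 = 1" "p $ 2 = - r"
    by (simp_all add: p_def)
  have bar_r: "bar r = (- q - \<iota> B) / (2 * \<iota> A)"
    using bar_q by (simp add: r_def)
  have bar_l: "bar l = (\<iota> a * q - T) / (2 * q)"
  proof -
    have "bar l = - (\<iota> a * q - T) / - (2 * q)"
      using bar_q by (simp add: l_def T_def)
    then show ?thesis
      by (simp only: minus_divide_divide)
  qed
  have coords: "\<iota> a * \<iota> c - \<iota> b ^ 2 = \<iota> A" "\<iota> a * \<iota> d - \<iota> b * \<iota> c = \<iota> B"
    "\<iota> b * \<iota> d - \<iota> c ^ 2 = \<iota> C" "\<iota> a * \<iota> B - 2 * \<iota> b * \<iota> A = T"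
    by (simp_all add: A_def B_def C_def T_def)
  have prems: "\<iota> A \<noteq> 0" "q \<noteq> 0" "q ^ 2 = \<iota> B ^ 2 - 4 * \<iota> A * \<iota> C"
    using A bar_q q(2) Q by simp_all
  note roots = hessian_roots[where a = "\<iota> a" and b = "\<iota> b" and c = "\<iota> c" and d = "\<iota> d" and q = q,
      unfolded coords, OF prems(1,2) two_neq_0_ext prems(3), folded bar_r bar_l, folded r_def l_def]
  have split: "base_ext \<iota> P = const2 l * lin_form p ^ 3 + const2 (bar l) * lin_form (cvec p) ^ 3"
    unfolding P base_ext_cubic scaled_cube_eq_cubic cubic_add cubic_eq_iff[OF three_neq_0_ext] cvec_nth p
    using roots by (simp add: algebra_simps eq_neg_iff_add_eq_0)
  have w: "wedge p (cvec p) = q / \<iota> A"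
    using roots(5) by (simp add: wedge_def p)
  \<comment> \<open>The discriminant is nonzero, so neither summand can vanish.\<close>
  have "q ^ 2 = (l * bar l * wedge p (cvec p) ^ 3) ^ 2"
    using q(2) Qn_base_ext[of P] split assms
      Qn_sum_of_scaled_cubes[OF three_neq_0_ext, of l p "bar l" "cvec p"]
    by (simp add: O_hat_def)
  then have "l \<noteq> 0"
    using bar_q by auto
  then show ?thesis
    using that[of l p] w split A bar_q by (simp add: is_decomposition_iff)
qed

text \<open>
  Polarising the equality of the two decompositions at \<open>(p, p, cvec p)\<close> and \<open>(p, cvec p, cvec p)\<close> kills
  the side of \<open>p\<close>. The two equations that remain contradict the independence of \<open>q\<close> and its conjugate
  unless \<open>q\<close> is proportional to \<open>p\<close> or to \<open>cvec p\<close>; the pure polarisations then compare the coefficients.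
\<close>

lemma decomposition_unique:
  assumes lp: "is_decomposition \<iota> P l p" and mq: "is_decomposition \<iota> P m q"
  obtains s where "s \<noteq> 0" "q = s *s p" "l = m * s ^ 3"
  | s where "s \<noteq> 0" "q = s *s cvec p" "bar l = m * s ^ 3"
proof -
  define w where "w = wedge p (cvec p)"
  define u where "u = wedge q p"
  define v where "v = wedge q (cvec p)"
  have w0: "w \<noteq> 0" "wedge q (cvec q) \<noteq> 0" and lm: "l \<noteq> 0" "m \<noteq> 0"
    using lp mq by (auto simp: is_decomposition_iff w_def)
  have wedges: "wedge p p = 0" "wedge (cvec p) (cvec p) = 0" "wedge (cvec p) p = - w"
    "wedge (cvec q) (cvec p) = bar u" "wedge (cvec q) p = bar v"
    unfolding w_def u_def v_def wedge_def cvec_nth by simp_all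
  have split: "const2 l * lin_form p ^ 3 + const2 (bar l) * lin_form (cvec p) ^ 3
      = const2 m * lin_form q ^ 3 + const2 (bar m) * lin_form (cvec q) ^ 3"
    using lp mq unfolding is_decomposition_iff by metis
  have pol: "l * wedge p x * wedge p y * wedge p z
      + bar l * wedge (cvec p) x * wedge (cvec p) y * wedge (cvec p) z
    = m * wedge q x * wedge q y * wedge q z
      + bar m * wedge (cvec q) x * wedge (cvec q) y * wedge (cvec q) z" for x y z
    by (rule polarised_sums_eq[OF three_neq_0_ext split])
  have 1: "m * u * u * v + bar m * bar v * bar v * bar u = 0"
    using pol[of p p "cvec p"] by (simp add: wedges flip: w_def u_def v_def)
  have 2: "m * u * v * v + bar m * bar v * bar u * bar u = 0"
    using pol[of p "cvec p" "cvec p"] by (simp add: wedges flip: w_def u_def v_def)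
  have "bar m * bar v * bar u * (v * bar v - u * bar u) = 0"
    using 1 2 by algebra
  moreover have "v * bar v - u * bar u = - (w * wedge q (cvec q))"
    unfolding w_def u_def v_def wedge_def cvec_nth by (simp add: algebra_simps)
  ultimately have "u = 0 \<or> v = 0"
    using w0 lm by auto
  moreover have q_eq: "w * q $ i = v * p $ i - u * cvec p $ i" for i
    using exhaust_2[of i] unfolding w_def u_def v_def wedge_def by (auto simp: algebra_simps)
  moreover have cube: "l * w ^ 3 = m * v ^ 3 + bar m * bar u ^ 3" "bar l * (- w) ^ 3 = m * u ^ 3 + bar m * bar v ^ 3"
    using pol[of "cvec p" "cvec p" "cvec p"] pol[of p p p]
    by (simp_all add: wedges power3_eq_cube mult.assoc flip: w_def u_def v_def)
  ultimately consider "u = 0" "q = (v / w) *s p" "l = m * (v / w) ^ 3"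
    | "v = 0" "q = (- u / w) *s cvec p" "bar l = m * (- u / w) ^ 3"
  proof (elim disjE)
    assume "u = 0"
    moreover from this have "q = (v / w) *s p"
      using q_eq w0 by (simp add: vec_eq_iff field_simps)
    moreover have "l = m * (v / w) ^ 3"
      using cube(1) w0 \<open>u = 0\<close> by (simp add: power_divide field_simps)
    ultimately show ?thesis
      using that(1) by blast
  next
    assume "v = 0"
    moreover from this have "q = (- u / w) *s cvec p"
      using q_eq w0 by (simp add: vec_eq_iff field_simps)
    moreover have "bar l = m * (- u / w) ^ 3"
    proof -
      have "bar l * w ^ 3 = - (m * u ^ 3)"
        using cube(2) \<open>v = 0\<close> by (simp add: minus_equation_iff)
      then have "bar l = - (m * u ^ 3) / w ^ 3"
        using w0(1) by (metis nonzero_eq_divide_eq power_not_zero)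
      then show ?thesis
        by (simp add: power_divide)
    qed
    ultimately show ?thesis
      using that(2) by blast
  qed
  then show ?thesis
  proof cases
    case 1
    with lm have "v / w \<noteq> 0"
      by auto
    with 1 that(1) show ?thesis by blast
  next
    case 2
    with lm have "- u / w \<noteq> 0"
      by auto
    with 2 that(2) show ?thesis by blast
  qed
qed

lemma wedge_scaled: "wedge (s *s p) (cvec (s *s p)) = s * bar s * wedge p (cvec p)"
  by (simp add: wedge_def algebra_simps)

lemma wedge_scaled_conj: "wedge (s *s cvec p) (cvec (s *s cvec p)) = - (s * bar s * wedge p (cvec p))"
  by (simp add: wedge_def algebra_simps)

text \<open>
  For two decompositions related by \<open>s\<close> as in \<open>decomposition_unique\<close>, the ratios differ by the cube of
  \<open>s / bar s\<close>, after an inversion if the summands are exchanged. In that case the antisymmetry of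
  \<open>omega\<close> changes the sign of the first component, so the \<open>Z\<^sub>2\<close>-classes agree.
\<close>

lemma I_hat_eq:
  assumes lp: "is_decomposition \<iota> P l p"
  shows "I_hat \<iota> P = Z2_class (omega_summands l p) (cube_class (l / bar l))"
proof -
  have same: "Z2_class (omega_summands m q) (cube_class (m / bar m))
    = Z2_class (omega_summands l p) (cube_class (l / bar l))" if mq: "is_decomposition \<iota> P m q" for m q
    using lp mq
  proof (cases rule: decomposition_unique)
    case (1 s)
    have "m \<noteq> 0"
      using mq by (simp add: is_decomposition_iff)
    have "omega_summands m q = omega_summands l p"
      unfolding omega_summands_def 1(2,3) wedge_scaled by (simp add: power_mult_distrib)
    moreover have "l / bar l = (s / bar s) ^ 3 * (m / bar m)"
      using 1(3) by (simp add: power_divide mult.commute)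
    then have "cube_class (l / bar l) = cube_class (m / bar m)"
      using 1(1) unfolding cube_class_eq_iff by (intro exI[of _ "s / bar s"]) simp
    ultimately show ?thesis
      by simp
  next
    case (2 s)
    have nz: "m \<noteq> 0" "l \<noteq> 0"
      using lp mq by (simp_all add: is_decomposition_iff)
    have l: "l = bar m * bar s ^ 3"
      using 2(3) by (metis bar_bar bar_mult bar_power)
    have "omega_summands m q = - omega_summands l p"
      unfolding omega_summands_def 2(2,3) wedge_scaled_conj
      by (simp add: l power_mult_distrib power3_eq_cube)
    moreover have "inverse (l / bar l) = (s / bar s) ^ 3 * (m / bar m)"
      using l by (simp add: power_divide mult.commute)
    then have "cube_class (inverse (l / bar l)) = cube_class (m / bar m)"
      using 2(1) unfolding cube_class_eq_iff by (intro exI[of _ "s / bar s"]) simp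
    then have "cube_class (m / bar m) = inv\<^bsub>cube_classes\<^esub> (cube_class (l / bar l))"
      using nz by (simp add: cube_class_inv)
    moreover have "cube_class (l / bar l) \<in> carrier cube_classes"
      using nz by (auto simp: carrier_cube_classes)
    ultimately show ?thesis
      by (simp add: Z2_class_swap)
  qed
  have "I_hat \<iota> P = (THE C. \<exists>m q. is_decomposition \<iota> P m q
      \<and> C = Z2_class (omega_summands m q) (cube_class (m / bar m)))"
    by (simp add: I_hat_def omega_scaled_cubes omega_summands_def divide_inverse flip: cvec_def)
  also have "\<dots> = Z2_class (omega_summands l p) (cube_class (l / bar l))"
    using lp same by (intro the_equality) blast+
  finally show ?thesis .
qed

text \<open>
  A quotient \<open>l / bar l\<close> even has norm 1 itself.
\<close>

lemma ratio_in_U: "l \<noteq> 0 \<Longrightarrow> cube_class (l / bar l) \<in> carrier (U_group \<iota>)"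
  by (auto simp: carrier_U_group intro!: imageI exI[of _ 1])

lemma I_hat_in_Im_times_U:
  assumes "P \<in> O_hat \<iota>"
  shows "I_hat \<iota> P \<in> Im_times_U \<iota>"
proof -
  obtain l p where "is_decomposition \<iota> P l p"
    using assms by (rule decomposition_exists)
  moreover from this have "l \<noteq> 0"
    by (simp add: is_decomposition_iff)
  ultimately show ?thesis
    unfolding Im_times_U_def using omega_summands_Im_star ratio_in_U I_hat_eq by blast
qed

end


section \<open>Orbits and the invariant\<close>

context quadratic_ext
begin

text \<open>
  The image of a form over the extension under the substitution \<open>x \<mapsto> u, y \<mapsto> v\<close> over the base field.
\<close>

definition transformed_form :: "'k ^ 2 \<Rightarrow> 'k ^ 2 \<Rightarrow> 'l ^ 2 \<Rightarrow> 'l ^ 2" where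
  "transformed_form u v p = (\<chi> i. p $ 1 * \<iota> (u $ i) + p $ 2 * \<iota> (v $ i))"

lemma wedge_transformed:
  "wedge (transformed_form u v p) (cvec (transformed_form u v p)) = \<iota> (wedge u v) * wedge p (cvec p)"
  by (simp add: transformed_form_def wedge_def algebra_simps)

lemma subst2_in_binary_cubics:
  assumes "P \<in> binary_cubics"
  shows "subst2 (lin_form u) (lin_form v) P \<in> binary_cubics"
proof -
  obtain a b c d where "P = cubic a b c d"
    using assms by (auto simp: binary_cubics_def)
  then show ?thesis
    unfolding binary_cubics_def by (simp only: subst2_lin_form_cubic) blast
qed

lemma subst2_decomposition:
  assumes P: "P \<in> binary_cubics" "is_decomposition \<iota> P l p" and uv: "wedge u v = 1"
  shows "is_decomposition \<iota> (subst2 (lin_form u) (lin_form v) P) l (transformed_form u v p)"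
proof -
  obtain a b c d where abcd: "P = cubic a b c d"
    using P(1) by (auto simp: binary_cubics_def)
  have eqs: "\<iota> a = l * p $ 1 ^ 3 + bar l * bar (p $ 1) ^ 3"
    "\<iota> b = l * p $ 1 ^ 2 * p $ 2 + bar l * bar (p $ 1) ^ 2 * bar (p $ 2)"
    "\<iota> c = l * p $ 1 * p $ 2 ^ 2 + bar l * bar (p $ 1) * bar (p $ 2) ^ 2"
    "\<iota> d = l * p $ 2 ^ 3 + bar l * bar (p $ 2) ^ 3"
    and nz: "l \<noteq> 0" "wedge p (cvec p) \<noteq> 0"
    using P(2) unfolding abcd is_decomposition_cubic_iff by auto
  show ?thesis
    unfolding abcd subst2_lin_form_cubic is_decomposition_cubic_iff wedge_transformed uv
    using nz by (auto simp: eqs transformed_form_def algebra_simps power2_eq_square power3_eq_cube)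
qed

lemma O_level_decomposition:
  assumes "P \<in> O_level \<iota> M" "M \<in> Im_star_sq \<iota>"
  obtains l p where "is_decomposition \<iota> P l p"
  using decomposition_exists[of P] assms by (auto simp: O_level_def O_hat_def)

lemma orbit_invariant:
  assumes P: "P \<in> O_level \<iota> M" and M: "M \<in> Im_star_sq \<iota>" and P': "P' \<in> SL2_orbit P"
  shows "P' \<in> O_level \<iota> M" "I_hat \<iota> P' = I_hat \<iota> P"
proof -
  obtain l p where lp: "is_decomposition \<iota> P l p"
    using P M by (rule O_level_decomposition)
  have bc: "P \<in> binary_cubics"
    using P by (simp add: O_level_def)
  obtain u v where uv: "P' = subst2 (lin_form u) (lin_form v) P" "wedge u v = 1"
    using P' by (auto simp: SL2_orbit_eq)
  have lp': "is_decomposition \<iota> P' l (transformed_form u v p)"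
    using subst2_decomposition[OF bc lp uv(2)] uv(1) by simp
  have same: "omega_summands l (transformed_form u v p) = omega_summands l p"
    by (simp add: omega_summands_def wedge_transformed uv)
  have bc': "P' \<in> binary_cubics"
    using subst2_in_binary_cubics[OF bc] uv(1) by simp
  show "P' \<in> O_level \<iota> M"
    using Qn_decomposition[OF bc lp] Qn_decomposition[OF bc' lp'] P bc' by (simp add: same O_level_def)
  show "I_hat \<iota> P' = I_hat \<iota> P"
    by (simp add: I_hat_eq[OF lp] I_hat_eq[OF lp'] same)
qed

text \<open>
  The aim is a scalar \<open>r\<close> with \<open>l r\<^sup>3 = m\<close> such that \<open>r q\<close> and its conjugate span the same area as \<open>p\<close> and its
  conjugate: the substitution taking \<open>p\<close> to \<open>r q\<close>, which is defined over the base field by \<open>form_onto\<close>, is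
  then unimodular and takes \<open>P\<close> to \<open>P'\<close>.
\<close>

lemma same_invariant_imp_orbit:
  assumes bc: "P \<in> binary_cubics" "P' \<in> binary_cubics"
    and lp: "is_decomposition \<iota> P l p" and mq: "is_decomposition \<iota> P' m q"
    and omega: "omega_summands l p = omega_summands m q"
    and cls: "cube_class (l / bar l) = cube_class (m / bar m)"
  shows "P' \<in> SL2_orbit P"
proof -
  define w where "w = wedge p (cvec p)"
  define w' where "w' = wedge q (cvec q)"
  have nz: "l \<noteq> 0" "m \<noteq> 0" "w \<noteq> 0" "w' \<noteq> 0" and bar_w: "bar w = - w" "bar w' = - w'"
    using lp mq bar_wedge by (auto simp: is_decomposition_iff w_def w'_def)
  obtain t where t: "t \<noteq> 0" "l / bar l = t ^ 3 * (m / bar m)"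
    using cls by (auto simp: cube_class_eq_iff)
  have "1 = (l / bar l) * bar (l / bar l)"
    using nz by simp
  also have "\<dots> = (t * bar t) ^ 3"
    using nz unfolding t(2) by (simp add: power_mult_distrib)
  finally obtain s where s: "s \<noteq> 0" "t ^ 3 * bar s ^ 3 = s ^ 3"
    using norm_one_cube[of t] by metis
  \<comment> \<open>Hilbert 90 makes \<open>\<kappa>\<close> conjugation invariant, so that equality of the values of \<open>omega\<close> reads \<open>\<kappa>\<^sup>2 = \<rho>\<^sup>3\<close>.\<close>
  define \<kappa> where "\<kappa> = l / (m * s ^ 3)"
  define \<rho> where "\<rho> = w' / (s * bar s * w)"
  have \<kappa>\<rho>0: "\<kappa> \<noteq> 0" "\<rho> \<noteq> 0"
    using nz s(1) by (simp_all add: \<kappa>_def \<rho>_def)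
  have "l * bar m = t ^ 3 * m * bar l"
    using t(2) nz by (simp add: field_simps)
  then have "l * bar m * bar s ^ 3 = m * bar l * s ^ 3"
    unfolding s(2)[symmetric] by simp
  then have bar_\<kappa>: "bar \<kappa> = \<kappa>"
    using nz s(1) by (simp add: \<kappa>_def field_simps)
  have bar_\<rho>: "bar \<rho> = \<rho>"
    by (simp add: \<rho>_def bar_w mult.commute)
  have "\<kappa> ^ 2 = \<kappa> * bar \<kappa>"
    by (simp add: bar_\<kappa> power2_eq_square)
  also have "\<dots> = l * bar l * w ^ 3 / (m * bar m * w ^ 3 * (s * bar s) ^ 3)"
    using nz s(1) by (simp add: \<kappa>_def power_mult_distrib)
  also have "l * bar l * w ^ 3 = m * bar m * w' ^ 3"
    using omega by (simp add: omega_summands_def w_def w'_def)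
  finally have \<kappa>_sq: "\<kappa> ^ 2 = \<rho> ^ 3"
    using nz s(1) by (simp add: \<rho>_def power_divide power_mult_distrib mult.commute)
  \<comment> \<open>By \<open>\<kappa>\<^sup>2 = \<rho>\<^sup>3\<close>, \<open>\<kappa>\<close> is the cube of \<open>\<kappa> / \<rho>\<close>, so \<open>l / m = \<kappa> s\<^sup>3\<close> is the cube of \<open>1 / r\<close>.\<close>
  define r where "r = \<rho> / (\<kappa> * s)"
  have "l * r ^ 3 = \<kappa> * (m * s ^ 3) * \<kappa> ^ 2 / (\<kappa> * s) ^ 3"
    using nz s(1) by (simp add: \<kappa>_sq r_def power_divide) (simp add: \<kappa>_def)
  also have "\<dots> = m"
    using \<kappa>\<rho>0 s(1) by (simp add: power_mult_distrib power2_eq_square power3_eq_cube)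
  finally have lr: "l * r ^ 3 = m" .
  have "r * bar r * w' = \<rho> ^ 3 * w / \<kappa> ^ 2"
  proof -
    have "w' = \<rho> * (s * bar s * w)"
      using nz s(1) by (simp add: \<rho>_def)
    then show ?thesis
      using \<kappa>\<rho>0 s(1) by (simp add: r_def bar_\<kappa> bar_\<rho> power2_eq_square power3_eq_cube)
  qed
  then have rw: "r * bar r * w' = w"
    using \<kappa>\<rho>0 by (simp add: \<kappa>_sq)
  obtain u1 v1 where 1: "r * q $ 1 = p $ 1 * \<iota> u1 + p $ 2 * \<iota> v1"
    using form_onto[of p "r * q $ 1"] nz(3) unfolding w_def by metis
  obtain u2 v2 where 2: "r * q $ 2 = p $ 1 * \<iota> u2 + p $ 2 * \<iota> v2"
    using form_onto[of p "r * q $ 2"] nz(3) unfolding w_def by metis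
  define u :: "'k ^ 2" where "u = (\<chi> i. if i = 1 then u1 else u2)"
  define v :: "'k ^ 2" where "v = (\<chi> i. if i = 1 then v1 else v2)"
  have tr: "transformed_form u v p = r *s q"
    using 1 2 by (simp add: transformed_form_def u_def v_def vec_eq_iff forall_2)
  have "\<iota> (wedge u v) * w = w"
    using wedge_transformed[of u v p] rw unfolding tr wedge_scaled by (simp add: w_def w'_def)
  then have uv: "wedge u v = 1"
    using nz(3) emb_eq_iff[of "wedge u v" 1] by simp
  have "base_ext \<iota> (subst2 (lin_form u) (lin_form v) P)
      = const2 l * lin_form (r *s q) ^ 3 + const2 (bar l) * lin_form (cvec (r *s q)) ^ 3"
    using subst2_decomposition[OF bc(1) lp uv] by (simp add: tr is_decomposition_iff)
  also have "\<dots> = const2 m * lin_form q ^ 3 + const2 (bar m) * lin_form (cvec q) ^ 3"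
    unfolding scaled_cube_eq_cubic lr[symmetric] by (simp add: power_mult_distrib algebra_simps power2_eq_square power3_eq_cube)
  also have "\<dots> = base_ext \<iota> P'"
    using mq by (simp add: is_decomposition_iff)
  finally have "P' = subst2 (lin_form u) (lin_form v) P"
    using base_ext_inject subst2_in_binary_cubics bc by metis
  with uv show ?thesis
    by (auto simp: SL2_orbit_eq)
qed

lemma decomposition_conj: "is_decomposition \<iota> P l p \<Longrightarrow> is_decomposition \<iota> P (bar l) (cvec p)"
proof -
  have "cvec (cvec p) = p" "wedge (cvec p) p = - wedge p (cvec p)"
    by (simp_all add: vec_eq_iff wedge_def)
  then show "is_decomposition \<iota> P l p \<Longrightarrow> ?thesis"
    by (simp add: is_decomposition_iff add.commute)
qed

lemma omega_summands_conj: "omega_summands (bar l) (cvec p) = - omega_summands l p"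
proof -
  have "wedge (cvec p) (cvec (cvec p)) = - wedge p (cvec p)"
    by (simp add: wedge_def)
  then show ?thesis
    by (simp add: omega_summands_def)
qed

text \<open>
  Two representatives of one \<open>Z\<^sub>2\<close>-class are equal or exchanged by the action; in the latter case the
  conjugate decomposition of \<open>P'\<close> has the data needed for \<open>same_invariant_imp_orbit\<close>.
\<close>

lemma SL2_orbit_eq_level_set:
  assumes P: "P \<in> O_level \<iota> M" and M: "M \<in> Im_star_sq \<iota>"
  shows "SL2_orbit P = {P' \<in> O_level \<iota> M. I_hat \<iota> P' = I_hat \<iota> P}"
proof (intro equalityI subsetI CollectI conjI)
  fix P'
  assume "P' \<in> {P' \<in> O_level \<iota> M. I_hat \<iota> P' = I_hat \<iota> P}"
  then have P': "P' \<in> O_level \<iota> M" and eq: "I_hat \<iota> P' = I_hat \<iota> P"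
    by auto
  obtain l p where lp: "is_decomposition \<iota> P l p"
    using P M by (rule O_level_decomposition)
  obtain m q where mq: "is_decomposition \<iota> P' m q"
    using P' M by (rule O_level_decomposition)
  have bc: "P \<in> binary_cubics" "P' \<in> binary_cubics"
    using P P' by (auto simp: O_level_def)
  have "Z2_class (omega_summands m q) (cube_class (m / bar m)) = Z2_class (omega_summands l p) (cube_class (l / bar l))"
    using eq by (simp add: I_hat_eq[OF lp] I_hat_eq[OF mq])
  then consider "omega_summands l p = omega_summands m q" "cube_class (l / bar l) = cube_class (m / bar m)"
    | "omega_summands l p = - omega_summands m q"
      "cube_class (l / bar l) = inv\<^bsub>cube_classes\<^esub> (cube_class (m / bar m))"
    by (auto simp: Z2_class_def doubleton_eq_iff)
  then show "P' \<in> SL2_orbit P"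
  proof cases
    case 1
    then show ?thesis
      by (rule same_invariant_imp_orbit[OF bc lp mq])
  next
    case 2
    have "m \<noteq> 0"
      using mq by (simp add: is_decomposition_iff)
    then have "cube_class (l / bar l) = cube_class (bar m / bar (bar m))"
      using 2(2) by (simp add: cube_class_inv)
    then show ?thesis
      using 2(1) by (intro same_invariant_imp_orbit[OF bc lp decomposition_conj[OF mq]])
        (simp_all add: omega_summands_conj)
  qed
qed (use orbit_invariant[OF P M] in auto)

text \<open>
  The coordinates of the sum of two conjugate summands are traces, hence lie in the base field.
\<close>

lemma decomposition_realised:
  assumes "l \<noteq> 0" "wedge p (cvec p) \<noteq> 0"
  obtains P where "P \<in> binary_cubics" "is_decomposition \<iota> P l p"
proof -
  have trace: "\<exists>a. \<iota> a = z + bar z" for z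
    using bar_fixed_imp_emb[of "z + bar z"] by (metis add.commute bar_add bar_bar)
  obtain a b c d where "\<iota> a = l * p $ 1 ^ 3 + bar (l * p $ 1 ^ 3)"
    "\<iota> b = l * p $ 1 ^ 2 * p $ 2 + bar (l * p $ 1 ^ 2 * p $ 2)"
    "\<iota> c = l * p $ 1 * p $ 2 ^ 2 + bar (l * p $ 1 * p $ 2 ^ 2)"
    "\<iota> d = l * p $ 2 ^ 3 + bar (l * p $ 2 ^ 3)"
    using trace by metis
  then have "is_decomposition \<iota> (cubic a b c d) l p"
    unfolding is_decomposition_cubic_iff using assms by simp
  then show ?thesis
    using that unfolding binary_cubics_def by blast
qed

text \<open>
  Let \<open>u\<close> be the class of \<open>z\<close>, where \<open>z bar z = t\<^sup>3\<close>. Then \<open>bar z / z = t\<^sup>3 / z\<^sup>2\<close> also represents \<open>u\<close>, so \<open>l\<close> can be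
  any multiple of \<open>bar z\<close> by an element of the base field. For \<open>l = bar z / N\<close> and a form \<open>p\<close> spanning the area \<open>q N\<close>
  with its conjugate, the value of \<open>omega\<close> is \<open>z bar z N q\<^sup>3\<close>, which dictates \<open>N\<close>.
\<close>

lemma I_hat_onto:
  assumes q: "q \<in> Im_star \<iota>" "q ^ 2 = M" and u: "u \<in> carrier (U_group \<iota>)"
  obtains P where "P \<in> O_level \<iota> M" "I_hat \<iota> P = Z2_class q u"
proof -
  obtain z t where z: "u = cube_class z" "z \<noteq> 0" "t \<noteq> 0" "z * bar z = t ^ 3"
    using u by (auto simp: carrier_U_group)
  note bar_q = Im_starD[OF q(1)]
  define N where "N = 1 / (z * bar z * q ^ 2)"
  have N: "N \<noteq> 0" "bar N = N"
    using z(2) bar_q by (simp_all add: N_def mult.commute)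
  define l where "l = bar z / N"
  define p :: "'l ^ 2" where "p = (\<chi> i. if i = 1 then 1 else - (q * N / 2))"
  have l: "l \<noteq> 0" "bar l = z / N"
    using N z(2) by (simp_all add: l_def)
  have w: "wedge p (cvec p) = q * N"
    using bar_q by (simp add: wedge_def p_def N(2))
  obtain P where P: "P \<in> binary_cubics" "is_decomposition \<iota> P l p"
    by (rule decomposition_realised[of l p]) (use l w N bar_q in simp_all)
  have "omega_summands l p = z * bar z * q ^ 2 * N * q"
    unfolding omega_summands_def w l(2) l_def
    using N by (simp add: power2_eq_square power3_eq_cube)
  also have "\<dots> = q"
    using z(2) bar_q by (simp add: N_def)
  finally have omega: "omega_summands l p = q" .
  have "l / bar l = bar z / z"
    using N by (simp add: l(2)) (simp add: l_def)
  also have "\<dots> = (t / z) ^ 3 * z"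
    unfolding power_divide z(4)[symmetric] using z(2) by (simp add: power3_eq_cube)
  finally have "cube_class (l / bar l) = u"
    using z by (auto simp: cube_class_eq_iff intro!: exI[of _ "t / z"])
  then have "I_hat \<iota> P = Z2_class q u"
    by (simp add: I_hat_eq[OF P(2)] omega)
  moreover have "P \<in> O_level \<iota> M"
    using Qn_decomposition[OF P] P(1) q(2) by (simp add: omega O_level_def)
  ultimately show ?thesis
    using that by blast
qed

text \<open>
  A zero \<open>v\<close> of \<open>P\<close> over the base field makes \<open>l / bar l\<close> the cube of \<open>- bar p(v) / p(v)\<close>. Conversely, if
  \<open>l / bar l = t\<^sup>3\<close>, then \<open>t\<^sup>3 = (s / bar s)\<^sup>3\<close> by Hilbert 90, and \<open>P\<close> vanishes at the \<open>v\<close> with \<open>p(v) = \<theta> bar s\<close> for an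
  imaginary \<open>\<theta>\<close>, whose conjugation supplies the sign.
\<close>

lemma reducible_iff_ratio_cube:
  assumes bc: "P \<in> binary_cubics" and lp: "is_decomposition \<iota> P l p"
  shows "reducible P \<longleftrightarrow> (\<exists>t. t \<noteq> 0 \<and> l / bar l = t ^ 3)"
proof -
  obtain a b c d where abcd: "P = cubic a b c d"
    using bc by (auto simp: binary_cubics_def)
  have eqs: "\<iota> a = l * p $ 1 ^ 3 + bar l * bar (p $ 1) ^ 3"
    "\<iota> b = l * p $ 1 ^ 2 * p $ 2 + bar l * bar (p $ 1) ^ 2 * bar (p $ 2)"
    "\<iota> c = l * p $ 1 * p $ 2 ^ 2 + bar l * bar (p $ 1) * bar (p $ 2) ^ 2"
    "\<iota> d = l * p $ 2 ^ 3 + bar l * bar (p $ 2) ^ 3"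
    and nz: "l \<noteq> 0" "wedge p (cvec p) \<noteq> 0"
    using lp unfolding abcd is_decomposition_cubic_iff by auto
  define val where "val x y = p $ 1 * \<iota> x + p $ 2 * \<iota> y" for x y
  have val0: "val x y = 0 \<longleftrightarrow> x = 0 \<and> y = 0" for x y
  proof
    assume "val x y = 0"
    then have "val x y * bar (p $ 2) - bar (val x y) * p $ 2 = 0"
      "bar (val x y) * p $ 1 - val x y * bar (p $ 1) = 0"
      by simp_all
    moreover have "val x y * bar (p $ 2) - bar (val x y) * p $ 2 = wedge p (cvec p) * \<iota> x"
      "bar (val x y) * p $ 1 - val x y * bar (p $ 1) = wedge p (cvec p) * \<iota> y"
      by (simp_all add: val_def wedge_def algebra_simps)
    ultimately show "x = 0 \<and> y = 0"
      using nz(2) by simp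
  qed (simp add: val_def)
  have "\<iota> (a * x ^ 3 + 3 * b * x ^ 2 * y + 3 * c * x * y ^ 2 + d * y ^ 3)
      = l * val x y ^ 3 + bar l * bar (val x y) ^ 3" for x y
    by (simp add: eqs val_def algebra_simps power2_eq_square power3_eq_cube)
  then have zero: "cubic_zero a b c d x y \<longleftrightarrow> val x y \<noteq> 0 \<and> l * val x y ^ 3 + bar l * bar (val x y) ^ 3 = 0"
    for x y
    unfolding cubic_zero_def val0 by (metis emb_eq_0_iff)
  have P0: "cubic a b c d \<noteq> 0"
  proof
    assume "cubic a b c d = 0"
    then have "Qn P = 0"
      by (simp add: abcd Qn_def cf_a_def cf_b_def cf_c_def cf_d_def)
    then show False
      using Qn_decomposition[OF bc lp] Im_starD[OF omega_summands_Im_star[OF lp]] by simp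
  qed
  show ?thesis
    unfolding abcd reducible_iff_zero[OF P0] zero
  proof (intro iffI; elim exE conjE)
    fix x y
    define \<zeta> where "\<zeta> = val x y"
    assume "val x y \<noteq> 0" "l * val x y ^ 3 + bar l * bar (val x y) ^ 3 = 0"
    then have "\<zeta> \<noteq> 0" "l * \<zeta> ^ 3 = - (bar l * bar \<zeta> ^ 3)"
      by (simp_all add: \<zeta>_def eq_neg_iff_add_eq_0)
    then have "l / bar l = (- bar \<zeta> / \<zeta>) ^ 3" "- bar \<zeta> / \<zeta> \<noteq> 0"
      using nz by (simp_all add: power_divide field_simps)
    then show "\<exists>t. t \<noteq> 0 \<and> l / bar l = t ^ 3"
      by blast
  next
    fix t
    assume t: "t \<noteq> 0" "l / bar l = t ^ 3"
    have "1 = (l / bar l) * bar (l / bar l)"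
      using nz by simp
    also have "\<dots> = (t * bar t) ^ 3"
      unfolding t(2) by (simp add: power_mult_distrib)
    finally obtain s where s: "s \<noteq> 0" "t ^ 3 * bar s ^ 3 = s ^ 3"
      using norm_one_cube[of t] by metis
    obtain \<theta> where \<theta>: "\<theta> \<noteq> 0" "bar \<theta> = - \<theta>"
      by (rule imaginary_exists)
    obtain x y where xy: "val x y = \<theta> * bar s"
      unfolding val_def using form_onto[OF nz(2), of "\<theta> * bar s"] by metis
    have "l = t ^ 3 * bar l"
      using t(2) nz by (simp add: field_simps)
    then have "l * bar s ^ 3 = bar l * s ^ 3"
      unfolding s(2)[symmetric] by (metis mult.assoc mult.commute)
    then have "l * val x y ^ 3 + bar l * bar (val x y) ^ 3 = 0"
      by (simp add: xy \<theta>(2) power_mult_distrib mult.left_commute)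
    moreover have "val x y \<noteq> 0"
      using \<theta>(1) s(1) by (simp add: xy)
    ultimately show "\<exists>x y. val x y \<noteq> 0 \<and> l * val x y ^ 3 + bar l * bar (val x y) ^ 3 = 0"
      by blast
  qed
qed

lemma I_orb_orbit:
  assumes "P \<in> O_level \<iota> M" "M \<in> Im_star_sq \<iota>"
  shows "I_hat \<iota> ` SL2_orbit P = {I_hat \<iota> P}" "I_orb \<iota> (SL2_orbit P) = I_hat \<iota> P"
proof -
  show "I_hat \<iota> ` SL2_orbit P = {I_hat \<iota> P}"
    using assms by (auto simp: SL2_orbit_eq_level_set)
  then show "I_orb \<iota> (SL2_orbit P) = I_hat \<iota> P"
    by (simp add: I_orb_def)
qed

lemma O_orbits_eq: "O_orbits \<iota> M = SL2_orbit ` O_level \<iota> M"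
  by (auto simp: O_orbits_def orbits_def SL2_orbit_def)

lemma I_orb_bij:
  assumes M: "M \<in> Im_star_sq \<iota>"
  shows "bij_betw (I_orb \<iota>) (O_orbits \<iota> M) (carrier (sq_fibre \<iota> M))"
proof -
  obtain q where q: "q \<in> Im_star \<iota>" "q ^ 2 = M"
    using M by (auto simp: Im_star_sq_def)
  have "I_orb \<iota> ` O_orbits \<iota> M = I_hat \<iota> ` O_level \<iota> M"
    unfolding O_orbits_eq image_image using I_orb_orbit(2)[OF _ M] by (rule image_cong[OF refl])
  also have "\<dots> = carrier (sq_fibre \<iota> M)"
  proof (intro equalityI subsetI)
    fix C
    assume "C \<in> I_hat \<iota> ` O_level \<iota> M"
    then obtain P where P: "P \<in> O_level \<iota> M" "C = I_hat \<iota> P"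
      by blast
    obtain l p where lp: "is_decomposition \<iota> P l p"
      using P(1) M by (rule O_level_decomposition)
    have "omega_summands l p ^ 2 = M"
      using Qn_decomposition[of P, OF _ lp] P(1) by (simp add: O_level_def)
    then have "carrier (sq_fibre \<iota> M) = Z2_class (omega_summands l p) ` carrier (U_group \<iota>)"
      by (rule carrier_sq_fibre[OF omega_summands_Im_star[OF lp]])
    moreover have "l \<noteq> 0"
      using lp by (simp add: is_decomposition_iff)
    ultimately show "C \<in> carrier (sq_fibre \<iota> M)"
      using ratio_in_U by (simp add: P(2) I_hat_eq[OF lp])
  next
    fix C
    assume "C \<in> carrier (sq_fibre \<iota> M)"
    then obtain u where "u \<in> carrier (U_group \<iota>)" "C = Z2_class q u"
      by (auto simp: carrier_sq_fibre[OF q])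
    then show "C \<in> I_hat \<iota> ` O_level \<iota> M"
      using I_hat_onto[OF q] by (metis imageI)
  qed
  finally have "I_orb \<iota> ` O_orbits \<iota> M = carrier (sq_fibre \<iota> M)" .
  moreover have "inj_on (I_orb \<iota>) (O_orbits \<iota> M)"
  proof (rule inj_onI)
    fix X Y
    assume "X \<in> O_orbits \<iota> M" "Y \<in> O_orbits \<iota> M" and eq: "I_orb \<iota> X = I_orb \<iota> Y"
    then obtain P P' where P: "P \<in> O_level \<iota> M" "X = SL2_orbit P" "P' \<in> O_level \<iota> M" "Y = SL2_orbit P'"
      by (auto simp: O_orbits_eq)
    then have "I_hat \<iota> P = I_hat \<iota> P'"
      using eq by (simp add: I_orb_orbit(2)[OF _ M])
    then show "X = Y"
      using P SL2_orbit_eq_level_set[OF _ M] by metis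
  qed
  ultimately show ?thesis
    by (simp add: bij_betw_def)
qed

lemma identity_orbit_iff_reducible:
  assumes P: "P \<in> O_level \<iota> M" and M: "M \<in> Im_star_sq \<iota>"
  shows "I_hat \<iota> P = \<one>\<^bsub>sq_fibre \<iota> M\<^esub> \<longleftrightarrow> reducible P"
proof -
  obtain l p where lp: "is_decomposition \<iota> P l p"
    using P M by (rule O_level_decomposition)
  have bc: "P \<in> binary_cubics"
    using P by (simp add: O_level_def)
  note q = omega_summands_Im_star[OF lp]
  have "omega_summands l p ^ 2 = M"
    using Qn_decomposition[OF bc lp] P by (simp add: O_level_def)
  then have "\<one>\<^bsub>sq_fibre \<iota> M\<^esub> = Z2_class (omega_summands l p) (cube_class 1)"
    using sq_fibre_one[OF q] by (simp add: one_U_group)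
  moreover have "omega_summands l p \<noteq> - omega_summands l p"
    using Im_starD[OF q] neq_minus_self by blast
  ultimately have "I_hat \<iota> P = \<one>\<^bsub>sq_fibre \<iota> M\<^esub> \<longleftrightarrow> cube_class (l / bar l) = cube_class 1"
    by (simp add: I_hat_eq[OF lp] Z2_class_eq_iff)
  then show ?thesis
    by (simp add: cube_class_eq_iff reducible_iff_ratio_cube[OF bc lp])
qed

end

theorem theorem3p45:
  fixes \<iota> :: "'k::field \<Rightarrow> 'l::field" and M :: 'l
  assumes "CHAR('k) \<noteq> 2" and "CHAR('k) \<noteq> 3"
    and "quadratic_extension \<iota>"
    and "M \<in> Im_star_sq \<iota>"
  shows "I_hat \<iota> \<in> O_hat \<iota> \<rightarrow> Im_times_U \<iota>
    \<and> (\<forall>P \<in> O_level \<iota> M. I_hat \<iota> ` SL2_orbit P = {I_hat \<iota> P})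
    \<and> bij_betw (I_orb \<iota>) (O_orbits \<iota> M) {C \<in> Im_times_U \<iota>. sq_hat C = M}
    \<and> (\<forall>q u v. q \<in> Im_star \<iota> \<longrightarrow> q ^ 2 = M
          \<longrightarrow> u \<in> carrier (U_group \<iota>) \<longrightarrow> v \<in> carrier (U_group \<iota>)
          \<longrightarrow> Z2_class q u \<otimes>\<^bsub>sq_fibre \<iota> M\<^esub> Z2_class q v = Z2_class q (u \<otimes>\<^bsub>U_group \<iota>\<^esub> v))
    \<and> group (sq_fibre \<iota> M)
    \<and> group (orbit_group \<iota> M)
    \<and> I_orb \<iota> \<in> iso (orbit_group \<iota> M) (sq_fibre \<iota> M)
    \<and> orbit_group \<iota> M \<cong> U_group \<iota>
    \<and> (\<forall>P \<in> O_level \<iota> M. SL2_orbit P = \<one>\<^bsub>orbit_group \<iota> M\<^esub> \<longleftrightarrow> reducible P)"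
proof -
  interpret quadratic_ext \<iota>
    using assms by unfold_locales
  note M = \<open>M \<in> Im_star_sq \<iota>\<close>
  obtain q where q: "q \<in> Im_star \<iota>" "q ^ 2 = M"
    using M by (auto simp: Im_star_sq_def)
  have fibre: "carrier (sq_fibre \<iota> M) = {C \<in> Im_times_U \<iota>. sq_hat C = M}"
    by (simp add: sq_fibre_def)
  note bij = I_orb_bij[OF M]
  note pullback = pullback_group_iso[OF group_sq_fibre[OF q] bij, folded orbit_group_def]
  have "U_group \<iota> \<cong> sq_fibre \<iota> M"
    using Z2_class_iso[OF q] by (auto simp: is_iso_def)
  then have "sq_fibre \<iota> M \<cong> U_group \<iota>"
    by (rule group.iso_sym[OF group_U_group])
  moreover have "orbit_group \<iota> M \<cong> sq_fibre \<iota> M"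
    using pullback(1) by (auto simp: is_iso_def)
  ultimately have iso_U: "orbit_group \<iota> M \<cong> U_group \<iota>"
    by (rule iso_trans[rotated])
  have "SL2_orbit P = \<one>\<^bsub>orbit_group \<iota> M\<^esub> \<longleftrightarrow> reducible P" if P: "P \<in> O_level \<iota> M" for P
    using pullback(3)[of "SL2_orbit P"] P
    by (simp add: O_orbits_eq I_orb_orbit(2)[OF P M] identity_orbit_iff_reducible[OF P M])
  then show ?thesis
    using I_hat_in_Im_times_U I_orb_orbit(1)[OF _ M] bij[unfolded fibre] sq_fibre_mult
      group_sq_fibre[OF q] pullback(1,2) iso_U
    by (intro conjI ballI allI impI funcsetI) simp_all
qed

end
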